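(* Let $\Gamma$ be a finitely generated group and let $Z\subset\mathrm{Sub}(\Gamma)$ be a generic uniformly recurrent subgroup. Then the $C^*$-algebra $C^*_r(Z)$ is simple.
   Context: $\mathrm{Sub}(\Gamma)$ is the compact space of subgroups of $\Gamma$, with $\Gamma$ acting by conjugation. A uniformly recurrent subgroup (URS) is a nonempty closed invariant $Z\subset\mathrm{Sub}(\Gamma)$ on which the action is minimal. A URS $Z$ is generic if for every $H\in Z$ the map $\Gamma/H\to\mathrm{Orb}(H)$, $gH\mapsto gHg^{-1}$, is a bijection, i.e. every $H\in Z$ is self-normalizing. Fix a finite generating system $Q=\{\gamma_1,\dots,\gamma_n\}$ of $\Gamma$. For $H\in\mathrm{Sub}(\Gamma)$ the Schreier graph $S=S^Q_\Gamma(H)$ has vertex set $\Gamma/H$, with a directed edge labeled $\gamma_i$ connecting $aH$ and $bH$ whenever $\gamma_i aH=bH$ (and one labeled $\gamma_i^{-1}$ if $\gamma_i bH=aH$); $d_S$ is the shortest path metric and $B_r(S,x)$ is the $r$-ball around $x$, as a rooted edge-labeled graph. Fix $H\in Z$ and $S=S^Q_\Gamma(H)$. A local kernel is a function $K:\Gamma/H\times\Gamma/H\to\mathbb{C}$ for which there is an integer $R>0$ such that (1) $K(x,y)=0$ if $d_S(x,y)>R$; (2) if $\theta:B_R(S,y)\to B_R(S,z)$ is a rooted-labeled isomorphism, then $K(y,w)=K(z,\theta(w))$ for all $w\in B_R(S,y)$. Local kernels form a unital $*$-algebra $\mathbb{C}Z$ with pointwise addition, $KL(x,y)=\sum_{z}K(x,z)L(z,y)$,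 and $K^*(x,y)=\overline{K(y,x)}$. It acts by bounded operators on $\ell^2(\Gamma/H)$ by $(Kf)(x)=\sum_y K(x,y)f(y)$, and $C^*_r(Z)$ is the norm closure of $\mathbb{C}Z$ in $B(\ell^2(\Gamma/H))$. (Up to canonical isomorphism this does not depend on the choice of $H\in Z$ or of $Q$.) *)

theory Defs
  imports
    "HOL-Analysis.Analysis"
    "HOL-Algebra.Left_Coset"
    "HOL-Algebra.Generated_Groups"
    "HOL-Algebra.Group_Action"
begin

section \<open>The space of subgroups and uniformly recurrent subgroups\<close>

definition subgroups_of :: "('a, 'm) monoid_scheme \<Rightarrow> 'a set set"
  where "subgroups_of G = {H. subgroup H G}"

text \<open>A subgroup is identified with its indicator function, a point of the compact space
  \<open>{False, True}\<close> to the power \<open>carrier G\<close>.\<close>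

definition Sub_topology :: "('a, 'm) monoid_scheme \<Rightarrow> 'a set topology"
  where "Sub_topology G =
    pullback_topology (subgroups_of G) (\<lambda>H. \<lambda>g\<in>carrier G. g \<in> H)
      (product_topology (\<lambda>_. discrete_topology (UNIV :: bool set)) (carrier G))"

definition conj_subgroup :: "('a, 'm) monoid_scheme \<Rightarrow> 'a \<Rightarrow> 'a set \<Rightarrow> 'a set"
  where "conj_subgroup G g H = g <#\<^bsub>G\<^esub> H #>\<^bsub>G\<^esub> (inv\<^bsub>G\<^esub> g)"

definition conj_invariant :: "('a, 'm) monoid_scheme \<Rightarrow> 'a set set \<Rightarrow> bool"
  where "conj_invariant G Z \<longleftrightarrow> (\<forall>g\<in>carrier G. \<forall>H\<in>Z. conj_subgroup G g H \<in> Z)"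

definition URS :: "('a, 'm) monoid_scheme \<Rightarrow> 'a set set \<Rightarrow> bool"
  where "URS G Z \<longleftrightarrow>
    Z \<noteq> {} \<and> closedin (Sub_topology G) Z \<and> conj_invariant G Z \<and>
    (\<forall>Y. Y \<subseteq> Z \<and> Y \<noteq> {} \<and> closedin (Sub_topology G) Y \<and> conj_invariant G Y \<longrightarrow> Y = Z)"

text \<open>The map \<open>\<phi>\<close> below is determined by its defining equation, as every left coset of \<open>H\<close> is of
  the form \<open>gH\<close>.\<close>

definition generic_URS :: "('a, 'm) monoid_scheme \<Rightarrow> 'a set set \<Rightarrow> bool"
  where "generic_URS G Z \<longleftrightarrow> URS G Z \<and>
    (\<forall>H\<in>Z. \<exists>\<phi>. (\<forall>g\<in>carrier G. \<phi> (g <#\<^bsub>G\<^esub> H) = conj_subgroup G g H) \<and>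
      bij_betw \<phi> (lcosets\<^bsub>G\<^esub> H) (orbit G (conj_subgroup G) H))"


section \<open>Schreier graphs and local kernels\<close>

text \<open>\<open>schreier_edge G Q H s x y\<close>: there is an edge with label \<open>s\<close> from \<open>x\<close> to \<open>y\<close>.\<close>

definition schreier_edge ::
    "('a, 'm) monoid_scheme \<Rightarrow> 'a set \<Rightarrow> 'a set \<Rightarrow> 'a \<Rightarrow> 'a set \<Rightarrow> 'a set \<Rightarrow> bool"
  where "schreier_edge G Q H s x y \<longleftrightarrow>
    x \<in> lcosets\<^bsub>G\<^esub> H \<and> y \<in> lcosets\<^bsub>G\<^esub> H \<and>
    (s \<in> Q \<and> s <#\<^bsub>G\<^esub> x = y \<or> (\<exists>\<gamma>\<in>Q. s = inv\<^bsub>G\<^esub> \<gamma> \<and> \<gamma> <#\<^bsub>G\<^esub> y = x))"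

text \<open>The least length of a path. The graph is connected when \<open>Q\<close> generates \<open>G\<close>; the value of
  \<open>LEAST\<close> is meaningful only in that case.\<close>

definition schreier_dist ::
    "('a, 'm) monoid_scheme \<Rightarrow> 'a set \<Rightarrow> 'a set \<Rightarrow> 'a set \<Rightarrow> 'a set \<Rightarrow> nat"
  where "schreier_dist G Q H x y =
    (LEAST n. (x, y) \<in> {(u, v). \<exists>s. schreier_edge G Q H s u v} ^^ n)"

definition schreier_ball ::
    "('a, 'm) monoid_scheme \<Rightarrow> 'a set \<Rightarrow> 'a set \<Rightarrow> nat \<Rightarrow> 'a set \<Rightarrow> 'a set set"
  where "schreier_ball G Q H r x = {y \<in> lcosets\<^bsub>G\<^esub> H. schreier_dist G Q H x y \<le> r}"

text \<open>A ball carries the edges of the graph between any two of its vertices.\<close>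

definition ball_iso ::
    "('a, 'm) monoid_scheme \<Rightarrow> 'a set \<Rightarrow> 'a set \<Rightarrow> nat \<Rightarrow> 'a set \<Rightarrow> 'a set \<Rightarrow>
      ('a set \<Rightarrow> 'a set) \<Rightarrow> bool"
  where "ball_iso G Q H r y z \<theta> \<longleftrightarrow>
    bij_betw \<theta> (schreier_ball G Q H r y) (schreier_ball G Q H r z) \<and> \<theta> y = z \<and>
    (\<forall>u\<in>schreier_ball G Q H r y. \<forall>v\<in>schreier_ball G Q H r y. \<forall>s.
      schreier_edge G Q H s u v \<longleftrightarrow> schreier_edge G Q H s (\<theta> u) (\<theta> v))"

text \<open>Only the values of \<open>K\<close> on pairs of left cosets of \<open>H\<close> are constrained or used.\<close>

definition local_kernel ::
    "('a, 'm) monoid_scheme \<Rightarrow> 'a set \<Rightarrow> 'a set \<Rightarrow> ('a set \<Rightarrow> 'a set \<Rightarrow> complex) \<Rightarrow> bool"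
  where "local_kernel G Q H K \<longleftrightarrow> (\<exists>R>0.
    (\<forall>x\<in>lcosets\<^bsub>G\<^esub> H. \<forall>y\<in>lcosets\<^bsub>G\<^esub> H. schreier_dist G Q H x y > R \<longrightarrow> K x y = 0) \<and>
    (\<forall>y\<in>lcosets\<^bsub>G\<^esub> H. \<forall>z\<in>lcosets\<^bsub>G\<^esub> H. \<forall>\<theta>. ball_iso G Q H R y z \<theta> \<longrightarrow>
      (\<forall>w\<in>schreier_ball G Q H R y. K y w = K z (\<theta> w))))"


section \<open>Bounded operators on \<open>\<ell>\<^sup>2(V)\<close>\<close>

text \<open>The index set \<open>V\<close> varies with \<open>H\<close>, so the Hilbert space is a set of functions rather than a
  type: \<open>\<ell>\<^sup>2(V)\<close> consists of functions vanishing off \<open>V\<close>. Operators are extended by \<open>0\<close> outside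
  \<open>\<ell>\<^sup>2(V)\<close>, so that equality of bounded operators is equality in HOL.\<close>

definition l2 :: "'v set \<Rightarrow> ('v \<Rightarrow> complex) set"
  where "l2 V = {f. (\<forall>x. x \<notin> V \<longrightarrow> f x = 0) \<and> (\<lambda>x. (cmod (f x))\<^sup>2) summable_on V}"

definition l2_norm :: "'v set \<Rightarrow> ('v \<Rightarrow> complex) \<Rightarrow> real"
  where "l2_norm V f = sqrt (\<Sum>\<^sub>\<infinity>x\<in>V. (cmod (f x))\<^sup>2)"

type_synonym 'v operator = "('v \<Rightarrow> complex) \<Rightarrow> ('v \<Rightarrow> complex)"

definition bounded_ops :: "'v set \<Rightarrow> 'v operator set"
  where "bounded_ops V = {T.
    (\<forall>f\<in>l2 V. T f \<in> l2 V) \<and>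
    (\<forall>f\<in>l2 V. \<forall>g\<in>l2 V. T (\<lambda>x. f x + g x) = (\<lambda>x. T f x + T g x)) \<and>
    (\<forall>f\<in>l2 V. \<forall>c. T (\<lambda>x. c * f x) = (\<lambda>x. c * T f x)) \<and>
    (\<exists>C. \<forall>f\<in>l2 V. l2_norm V (T f) \<le> C * l2_norm V f) \<and>
    (\<forall>f. f \<notin> l2 V \<longrightarrow> T f = (\<lambda>x. 0))}"

definition op_zero :: "'v operator"
  where "op_zero = (\<lambda>f x. 0)"

definition op_add :: "'v operator \<Rightarrow> 'v operator \<Rightarrow> 'v operator"
  where "op_add S T = (\<lambda>f x. S f x + T f x)"

definition op_diff :: "'v operator \<Rightarrow> 'v operator \<Rightarrow> 'v operator"
  where "op_diff S T = (\<lambda>f x. S f x - T f x)"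

definition op_scale :: "complex \<Rightarrow> 'v operator \<Rightarrow> 'v operator"
  where "op_scale c T = (\<lambda>f x. c * T f x)"

definition op_norm :: "'v set \<Rightarrow> 'v operator \<Rightarrow> real"
  where "op_norm V T = (SUP f\<in>{f \<in> l2 V. l2_norm V f \<le> 1}. l2_norm V (T f))"

definition norm_closure :: "'v set \<Rightarrow> 'v operator set \<Rightarrow> 'v operator set"
  where "norm_closure V A =
    {T \<in> bounded_ops V. \<forall>\<epsilon>>0. \<exists>S\<in>A. op_norm V (op_diff T S) < \<epsilon>}"

definition closed_two_sided_ideal :: "'v set \<Rightarrow> 'v operator set \<Rightarrow> 'v operator set \<Rightarrow> bool"
  where "closed_two_sided_ideal V A I \<longleftrightarrow>
    I \<subseteq> A \<and> op_zero \<in> I \<and>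
    (\<forall>S\<in>I. \<forall>T\<in>I. op_add S T \<in> I) \<and>
    (\<forall>c. \<forall>S\<in>I. op_scale c S \<in> I) \<and>
    (\<forall>T\<in>A. \<forall>S\<in>I. T \<circ> S \<in> I \<and> S \<circ> T \<in> I) \<and>
    norm_closure V I = I"

text \<open>Simplicity of a \<open>C\<^sup>*\<close>-algebra \<open>A\<close> of bounded operators on \<open>\<ell>\<^sup>2(V)\<close>.\<close>

definition simple_cstar :: "'v set \<Rightarrow> 'v operator set \<Rightarrow> bool"
  where "simple_cstar V A \<longleftrightarrow>
    A \<noteq> {op_zero} \<and> (\<forall>I. closed_two_sided_ideal V A I \<longrightarrow> I = {op_zero} \<or> I = A)"


section \<open>The \<open>C\<^sup>*\<close>-algebra of a uniformly recurrent subgroup\<close>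

definition kernel_op :: "'v set \<Rightarrow> ('v \<Rightarrow> 'v \<Rightarrow> complex) \<Rightarrow> 'v operator"
  where "kernel_op V K =
    (\<lambda>f x. if f \<in> l2 V \<and> x \<in> V then \<Sum>\<^sub>\<infinity>y\<in>V. K x y * f y else 0)"

definition cstar_r :: "('a, 'm) monoid_scheme \<Rightarrow> 'a set \<Rightarrow> 'a set \<Rightarrow> 'a set operator set"
  where "cstar_r G Q H =
    norm_closure (lcosets\<^bsub>G\<^esub> H) (kernel_op (lcosets\<^bsub>G\<^esub> H) ` {K. local_kernel G Q H K})"

end

theory Submission
  imports Defs
begin

text \<open>
  A local kernel is a function \<open>K\<close> supported on pairs \<open>(x, g x)\<close> with \<open>g\<close> in a finite set \<open>E\<close>, whose
  value \<open>K x (g x)\<close> depends only on which elements of some finite set \<open>F\<close> fix \<open>x\<close>. Let \<open>I\<close> be a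
  nonzero closed ideal. After composing with a translation, some \<open>T\<close> in \<open>I\<close> has a nonzero diagonal entry
  at a vertex \<open>y\<close>; approximate \<open>T\<close> by a local kernel \<open>K\<close>. Distinct vertices have distinct stabilizers,
  as the URS is generic, so by compactness there is a finite set \<open>F'\<close> of group elements that separates the
  stabilizers of \<open>x\<close> and \<open>g x \<noteq> x\<close> for all \<open>g\<close> in \<open>E\<close>. Let \<open>P\<close> be the coordinate projection onto the
  vertices whose stabilizer agrees with that of \<open>y\<close> on \<open>E \<union> F \<union> F'\<close>. Then \<open>P K P = K(y, y) P\<close>, hence
  \<open>P T P\<close> is close to a nonzero multiple of \<open>P\<close> and \<open>P\<close> itself lies in \<open>I\<close>. By minimality finitely many
  translates of the range of \<open>P\<close> cover all vertices, so the identity lies in \<open>I\<close>.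
\<close>

section \<open>Operators on \<open>\<ell>\<^sup>2(V)\<close>\<close>

lemma l2_summable: "f \<in> l2 V \<Longrightarrow> (\<lambda>x. (cmod (f x))\<^sup>2) summable_on V"
  by (simp add: l2_def)

lemma l2_outside: "f \<in> l2 V \<Longrightarrow> x \<notin> V \<Longrightarrow> f x = 0"
  by (simp add: l2_def)

lemma l2_norm_nonneg [simp]: "0 \<le> l2_norm V f"
  by (simp add: l2_norm_def infsum_nonneg)

lemma l2_norm_square: "(l2_norm V f)\<^sup>2 = (\<Sum>\<^sub>\<infinity>x\<in>V. (cmod (f x))\<^sup>2)"
  by (simp add: l2_norm_def infsum_nonneg)

lemma l2_zero [simp]: "(\<lambda>x. 0) \<in> l2 V"
  by (simp add: l2_def)

lemma l2_norm_zero [simp]: "l2_norm V (\<lambda>x. 0) = 0"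
  by (simp add: l2_norm_def)

lemma l2_majorized:
  assumes "\<And>x. x \<notin> V \<Longrightarrow> g x = 0" "h summable_on V" "\<And>x. x \<in> V \<Longrightarrow> (cmod (g x))\<^sup>2 \<le> h x"
  shows "g \<in> l2 V" "(l2_norm V g)\<^sup>2 \<le> infsum h V"
proof -
  have s: "(\<lambda>x. (cmod (g x))\<^sup>2) summable_on V"
    by (rule summable_on_comparison_test[OF assms(2)]) (use assms(3) in auto)
  with assms(1) show "g \<in> l2 V" by (simp add: l2_def)
  show "(l2_norm V g)\<^sup>2 \<le> infsum h V"
    unfolding l2_norm_square by (rule infsum_mono[OF s assms(2,3)])
qed

lemma l2_dominated:
  assumes "f \<in> l2 V" "0 \<le> C" "\<And>x. cmod (g x) \<le> C * cmod (f x)"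
  shows "g \<in> l2 V" "l2_norm V g \<le> C * l2_norm V f"
proof -
  have 1: "g x = 0" if "x \<notin> V" for x
    using assms(3)[of x] l2_outside[OF assms(1) that] by simp
  have 2: "(\<lambda>x. C\<^sup>2 * (cmod (f x))\<^sup>2) summable_on V"
    by (intro summable_on_cmult_right l2_summable assms)
  have 3: "(cmod (g x))\<^sup>2 \<le> C\<^sup>2 * (cmod (f x))\<^sup>2" for x
    using power_mono[OF assms(3)[of x], of 2] by (simp add: power_mult_distrib)
  show "g \<in> l2 V" by (rule l2_majorized[OF 1 2 3])
  have "(l2_norm V g)\<^sup>2 \<le> (C * l2_norm V f)\<^sup>2"
    using l2_majorized(2)[OF 1 2 3]
    by (simp add: infsum_cmult_right' l2_norm_square power_mult_distrib)
  then show "l2_norm V g \<le> C * l2_norm V f"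
    by (rule power2_le_imp_le) (simp add: assms(2))
qed

lemma l2_scale:
  assumes "f \<in> l2 V"
  shows "(\<lambda>x. c * f x) \<in> l2 V" "l2_norm V (\<lambda>x. c * f x) \<le> cmod c * l2_norm V f"
  using l2_dominated[OF assms, of "cmod c" "\<lambda>x. c * f x"] by (auto simp: norm_mult)

text \<open>A crude pointwise substitute for the triangle inequality in \<open>l2 V\<close>: it
  gives closure under sums and boundedness of differences of operators, where no sharp constant
  matters.\<close>

lemma cmod_diff_square_le: "(cmod (a - b))\<^sup>2 \<le> 2 * (cmod a)\<^sup>2 + 2 * (cmod b)\<^sup>2"
proof -
  have "(cmod (a - b))\<^sup>2 \<le> (cmod a + cmod b)\<^sup>2"
    by (intro power_mono norm_triangle_ineq4) auto
  also have "\<dots> \<le> 2 * (cmod a)\<^sup>2 + 2 * (cmod b)\<^sup>2"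
    using zero_le_power2[of "cmod a - cmod b"] by (simp add: power2_eq_square algebra_simps)
  finally show ?thesis .
qed

lemma l2_diff:
  assumes "f \<in> l2 V" "g \<in> l2 V"
  shows "(\<lambda>x. f x - g x) \<in> l2 V"
    "(l2_norm V (\<lambda>x. f x - g x))\<^sup>2 \<le> 2 * (l2_norm V f)\<^sup>2 + 2 * (l2_norm V g)\<^sup>2"
proof -
  let ?h = "\<lambda>x. 2 * (cmod (f x))\<^sup>2 + 2 * (cmod (g x))\<^sup>2"
  have s: "(\<lambda>x. 2 * (cmod (f x))\<^sup>2) summable_on V" "(\<lambda>x. 2 * (cmod (g x))\<^sup>2) summable_on V"
    by (intro summable_on_cmult_right l2_summable assms)+
  have 1: "f x - g x = 0" if "x \<notin> V" for x
    using that assms by (simp add: l2_outside)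
  have 2: "?h summable_on V" by (intro summable_on_add s)
  show "(\<lambda>x. f x - g x) \<in> l2 V" by (rule l2_majorized[OF 1 2 cmod_diff_square_le])
  show "(l2_norm V (\<lambda>x. f x - g x))\<^sup>2 \<le> 2 * (l2_norm V f)\<^sup>2 + 2 * (l2_norm V g)\<^sup>2"
    using l2_majorized(2)[OF 1 2 cmod_diff_square_le]
    by (simp add: infsum_add[OF s] infsum_cmult_right' l2_norm_square)
qed

lemma l2_add: "f \<in> l2 V \<Longrightarrow> g \<in> l2 V \<Longrightarrow> (\<lambda>x. f x + g x) \<in> l2 V"
  using l2_diff(1)[of f V "\<lambda>x. (-1) * g x"] l2_scale(1)[of g V "-1"] by simp

lemma cmod_le_l2_norm:
  assumes "f \<in> l2 V" "x \<in> V"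
  shows "cmod (f x) \<le> l2_norm V f"
proof -
  have "(\<Sum>\<^sub>\<infinity>x\<in>{x}. (cmod (f x))\<^sup>2) \<le> (\<Sum>\<^sub>\<infinity>x\<in>V. (cmod (f x))\<^sup>2)"
    by (rule infsum_mono2) (use assms in \<open>auto simp: l2_summable\<close>)
  then have "(cmod (f x))\<^sup>2 \<le> (l2_norm V f)\<^sup>2"
    unfolding l2_norm_square by simp
  then show ?thesis by (rule power2_le_imp_le) simp
qed

lemma l2_norm_eq_0D:
  assumes "f \<in> l2 V" "l2_norm V f \<le> 0"
  shows "f = (\<lambda>x. 0)"
proof
  fix x
  show "f x = 0"
    using cmod_le_l2_norm[OF assms(1), of x] assms(2) l2_outside[OF assms(1), of x]
    by (metis norm_le_zero_iff order_trans)
qed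

definition basis_vec :: "'v \<Rightarrow> 'v \<Rightarrow> complex"
  where "basis_vec y = (\<lambda>x. if x = y then 1 else 0)"

lemma l2_finite_support:
  assumes "finite F" "F \<subseteq> V" "\<And>x. x \<notin> F \<Longrightarrow> f x = 0"
  shows "f \<in> l2 V" "(l2_norm V f)\<^sup>2 = (\<Sum>x\<in>F. (cmod (f x))\<^sup>2)"
proof -
  have "(\<lambda>x. (cmod (f x))\<^sup>2) summable_on V \<longleftrightarrow> (\<lambda>x. (cmod (f x))\<^sup>2) summable_on F"
    by (rule summable_on_cong_neutral) (use assms in auto)
  then have "(\<lambda>x. (cmod (f x))\<^sup>2) summable_on V"
    using summable_on_finite[OF assms(1)] by blast
  then show "f \<in> l2 V" using assms by (auto simp: l2_def)
  have "(\<Sum>\<^sub>\<infinity>x\<in>V. (cmod (f x))\<^sup>2) = (\<Sum>\<^sub>\<infinity>x\<in>F. (cmod (f x))\<^sup>2)"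
    by (rule infsum_cong_neutral) (use assms in auto)
  then show "(l2_norm V f)\<^sup>2 = (\<Sum>x\<in>F. (cmod (f x))\<^sup>2)"
    by (simp add: l2_norm_square assms)
qed

lemma basis_vec_l2 [simp]: "y \<in> V \<Longrightarrow> basis_vec y \<in> l2 V"
  using l2_finite_support(1)[of "{y}" V "basis_vec y"] by (simp add: basis_vec_def)

lemma l2_norm_basis_vec: "y \<in> V \<Longrightarrow> l2_norm V (basis_vec y) = 1"
proof -
  assume "y \<in> V"
  then have "(l2_norm V (basis_vec y))\<^sup>2 = 1\<^sup>2"
    using l2_finite_support(2)[of "{y}" V "basis_vec y"] by (simp add: basis_vec_def)
  then show ?thesis by (rule power2_eq_imp_eq) simp_all
qed

subsection \<open>Bounded operators\<close>

lemma bounded_opsD: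
  assumes "T \<in> bounded_ops V"
  shows "f \<in> l2 V \<Longrightarrow> T f \<in> l2 V"
    and "f \<in> l2 V \<Longrightarrow> g \<in> l2 V \<Longrightarrow> T (\<lambda>x. f x + g x) = (\<lambda>x. T f x + T g x)"
    and "f \<in> l2 V \<Longrightarrow> T (\<lambda>x. c * f x) = (\<lambda>x. c * T f x)"
    and "f \<notin> l2 V \<Longrightarrow> T f = (\<lambda>x. 0)"
  using assms by (auto simp: bounded_ops_def)

lemma bounded_ops_bound:
  assumes "T \<in> bounded_ops V"
  obtains C where "0 \<le> C" "\<And>f. f \<in> l2 V \<Longrightarrow> l2_norm V (T f) \<le> C * l2_norm V f"
proof -
  obtain C where C: "\<forall>f\<in>l2 V. l2_norm V (T f) \<le> C * l2_norm V f"
    using assms by (auto simp: bounded_ops_def)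
  have "l2_norm V (T f) \<le> max C 0 * l2_norm V f" if "f \<in> l2 V" for f
    using C[rule_format, OF that] mult_right_mono[of C "max C 0" "l2_norm V f"] by simp
  then show ?thesis using that[of "max C 0"] by simp
qed

lemma bounded_ops_zero:
  assumes "T \<in> bounded_ops V"
  shows "T (\<lambda>x. 0) = (\<lambda>x. 0)"
  using bounded_opsD(3)[OF assms, of "\<lambda>x. 0" 0] by simp

lemma bounded_ops_diff:
  assumes "T \<in> bounded_ops V" "f \<in> l2 V" "g \<in> l2 V"
  shows "T (\<lambda>x. f x - g x) = (\<lambda>x. T f x - T g x)"
  using bounded_opsD(2)[OF assms(1,2) l2_scale(1)[OF assms(3), of "-1"]]
    bounded_opsD(3)[OF assms(1,3), of "-1"] by simp

lemma op_diff_bounded: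
  assumes "S \<in> bounded_ops V" "T \<in> bounded_ops V"
  shows "op_diff S T \<in> bounded_ops V"
proof -
  obtain C where C: "0 \<le> C" "\<And>f. f \<in> l2 V \<Longrightarrow> l2_norm V (S f) \<le> C * l2_norm V f"
    using bounded_ops_bound[OF assms(1)] by blast
  obtain D where D: "0 \<le> D" "\<And>f. f \<in> l2 V \<Longrightarrow> l2_norm V (T f) \<le> D * l2_norm V f"
    using bounded_ops_bound[OF assms(2)] by blast
  have "l2_norm V (op_diff S T f) \<le> sqrt (2 * C\<^sup>2 + 2 * D\<^sup>2) * l2_norm V f" if f: "f \<in> l2 V" for f
  proof -
    have "(l2_norm V (op_diff S T f))\<^sup>2 \<le> 2 * (l2_norm V (S f))\<^sup>2 + 2 * (l2_norm V (T f))\<^sup>2"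
      unfolding op_diff_def by (intro l2_diff(2) bounded_opsD(1)[OF _ f] assms)
    also have "\<dots> \<le> 2 * (C * l2_norm V f)\<^sup>2 + 2 * (D * l2_norm V f)\<^sup>2"
      by (intro add_mono mult_left_mono power_mono C D f) auto
    also have "\<dots> = (sqrt (2 * C\<^sup>2 + 2 * D\<^sup>2) * l2_norm V f)\<^sup>2"
      by (simp add: power_mult_distrib algebra_simps)
    finally show ?thesis by (rule power2_le_imp_le) simp
  qed
  then have "\<exists>C. \<forall>f\<in>l2 V. l2_norm V (op_diff S T f) \<le> C * l2_norm V f" by blast
  then show ?thesis
    using assms by (auto simp: bounded_ops_def op_diff_def algebra_simps intro!: l2_diff(1))
qed

lemma op_norm_le:
  assumes "0 \<le> C" "\<And>f. f \<in> l2 V \<Longrightarrow> l2_norm V (T f) \<le> C * l2_norm V f"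
  shows "op_norm V T \<le> C"
  unfolding op_norm_def
proof (rule cSUP_least)
  show "{f \<in> l2 V. l2_norm V f \<le> 1} \<noteq> {}"
    using l2_zero[of V] by (auto intro!: exI[of _ "\<lambda>x. 0"])
  fix f assume "f \<in> {f \<in> l2 V. l2_norm V f \<le> 1}"
  then show "l2_norm V (T f) \<le> C"
    using assms(2)[of f] mult_left_mono[OF _ assms(1), of "l2_norm V f" 1] by auto
qed

text \<open>The supremum in \<open>op_norm\<close> runs over the unit ball only, so \<open>f\<close>
  is rescaled to \<open>g\<close> of norm at most 1.\<close>

lemma l2_norm_le_op_norm:
  assumes "T \<in> bounded_ops V" "f \<in> l2 V"
  shows "l2_norm V (T f) \<le> op_norm V T * l2_norm V f"
proof -
  obtain C where C: "0 \<le> C" "\<And>f. f \<in> l2 V \<Longrightarrow> l2_norm V (T f) \<le> C * l2_norm V f"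
    using bounded_ops_bound[OF assms(1)] by blast
  show ?thesis
  proof (cases "l2_norm V f = 0")
    case True
    then show ?thesis using C(2)[OF assms(2)] by simp
  next
    case False
    define r where "r = l2_norm V f"
    have r: "r > 0" using False l2_norm_nonneg[of V f] unfolding r_def by linarith
    define g where "g = (\<lambda>x. complex_of_real (1 / r) * f x)"
    have g: "g \<in> l2 V" unfolding g_def by (rule l2_scale(1)[OF assms(2)])
    have "l2_norm V g \<le> 1"
      using l2_scale(2)[OF assms(2), of "complex_of_real (1 / r)"] r
      by (simp add: g_def r_def[symmetric] norm_divide)
    \<comment> \<open>On the reals \<open>SUP\<close> is an upper bound only of a set known to be
      bounded above; boundedness of \<open>T\<close> provides this.\<close>
    moreover have "bdd_above ((\<lambda>f. l2_norm V (T f)) ` {f \<in> l2 V. l2_norm V f \<le> 1})"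
    proof (rule bdd_aboveI2)
      fix h assume "h \<in> {f \<in> l2 V. l2_norm V f \<le> 1}"
      then show "l2_norm V (T h) \<le> C"
        using C(2)[of h] mult_left_mono[OF _ C(1), of "l2_norm V h" 1] by auto
    qed
    ultimately have le: "l2_norm V (T g) \<le> op_norm V T"
      unfolding op_norm_def using g by (intro cSUP_upper) auto
    have "f = (\<lambda>x. complex_of_real r * g x)" using r by (auto simp: g_def)
    then have "T f = (\<lambda>x. complex_of_real r * T g x)"
      using bounded_opsD(3)[OF assms(1) g] by metis
    then have "l2_norm V (T f) \<le> r * l2_norm V (T g)"
      using l2_scale(2)[OF bounded_opsD(1)[OF assms(1) g], of "complex_of_real r"] r by simp
    also have "\<dots> \<le> r * op_norm V T" using le r by simp
    finally show ?thesis by (simp add: r_def mult.commute)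
  qed
qed

lemma norm_closureI:
  assumes "S \<in> A" "S \<in> bounded_ops V"
  shows "S \<in> norm_closure V A"
proof -
  have "op_norm V (op_diff S S) \<le> 0" by (rule op_norm_le) (simp_all add: op_diff_def)
  then have "\<forall>\<epsilon>>0. \<exists>S'\<in>A. op_norm V (op_diff S S') < \<epsilon>" using assms by force
  then show ?thesis using assms by (simp add: norm_closure_def)
qed

text \<open>Finite truncations of \<open>f\<close> are combinations of basis vectors and approximate
  \<open>f\<close> in norm, so \<open>T\<close> sees only an arbitrarily small tail of
  \<open>f\<close>.\<close>

lemma bounded_op_eq_zeroI:
  assumes T: "T \<in> bounded_ops V" and b: "\<And>y. y \<in> V \<Longrightarrow> T (basis_vec y) = (\<lambda>x. 0)"
  shows "T = op_zero"
proof
  fix f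
  show "T f = op_zero f"
  proof (cases "f \<in> l2 V")
    case False
    then show ?thesis using bounded_opsD(4)[OF T] by (simp add: op_zero_def)
  next
    case f: True
    obtain C where C: "0 \<le> C" "\<And>f. f \<in> l2 V \<Longrightarrow> l2_norm V (T f) \<le> C * l2_norm V f"
      using bounded_ops_bound[OF T] by blast
    define trunc where "trunc F = (\<lambda>x. if x \<in> F then f x else 0)" for F
    have trunc: "trunc F \<in> l2 V \<and> T (trunc F) = (\<lambda>x. 0)" if "finite F" "F \<subseteq> V" for F
      using that
    proof (induction F rule: finite_induct)
      case empty
      then show ?case by (simp add: trunc_def bounded_ops_zero[OF T])
    next
      case (insert y F)
      have eq: "trunc (insert y F) = (\<lambda>x. trunc F x + f y * basis_vec y x)"
        using insert.hyps by (auto simp: trunc_def basis_vec_def)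
      have y: "basis_vec y \<in> l2 V" using insert.prems by simp
      have IH: "trunc F \<in> l2 V" "T (trunc F) = (\<lambda>x. 0)" using insert by auto
      have Ty: "T (basis_vec y) = (\<lambda>x. 0)" using b insert.prems by blast
      have s: "(\<lambda>x. f y * basis_vec y x) \<in> l2 V" by (rule l2_scale(1)[OF y])
      have "T (\<lambda>x. trunc F x + f y * basis_vec y x) = (\<lambda>x. 0)"
        unfolding bounded_opsD(2)[OF T IH(1) s] bounded_opsD(3)[OF T y] IH(2) Ty by simp
      then show ?case using l2_add[OF IH(1) s] unfolding eq by simp
    qed
    have "(l2_norm V (T f))\<^sup>2 \<le> e" if "e > 0" for e
    proof -
      \<comment> \<open>The summand 1 keeps the denominator positive when \<open>C\<close> is 0, and
        \<open>C\<^sup>2 * d\<close> stays at most \<open>e\<close>.\<close>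
      define d where "d = e / (C\<^sup>2 + 1)"
      have d: "d > 0" using that by (simp add: d_def add_nonneg_pos)
      obtain F where F: "finite F" "F \<subseteq> V"
        "dist (\<Sum>x\<in>F. (cmod (f x))\<^sup>2) (\<Sum>\<^sub>\<infinity>x\<in>V. (cmod (f x))\<^sup>2) \<le> d"
        using infsum_finite_approximation[OF l2_summable[OF f] d] by blast
      define h where "h = (\<lambda>x. f x - trunc F x)"
      have h: "h \<in> l2 V" unfolding h_def using trunc[OF F(1,2)] f l2_diff(1) by blast
      have "T h = T f"
        unfolding h_def using trunc[OF F(1,2)] bounded_ops_diff[OF T f] by simp
      have sub: "(\<lambda>x. (cmod (f x))\<^sup>2) summable_on V - F"
        by (rule summable_on_subset_banach[OF l2_summable[OF f]]) auto
      have "(l2_norm V h)\<^sup>2 = (\<Sum>\<^sub>\<infinity>x\<in>V - F. (cmod (f x))\<^sup>2)"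
        unfolding l2_norm_square by (rule infsum_cong_neutral) (auto simp: h_def trunc_def)
      also have "\<dots> \<le> d"
      proof -
        have "(\<Sum>\<^sub>\<infinity>x\<in>F \<union> (V - F). (cmod (f x))\<^sup>2)
            = (\<Sum>\<^sub>\<infinity>x\<in>F. (cmod (f x))\<^sup>2) + (\<Sum>\<^sub>\<infinity>x\<in>V - F. (cmod (f x))\<^sup>2)"
          by (rule infsum_Un_disjoint) (use F sub in \<open>auto intro: summable_on_finite\<close>)
        moreover have "F \<union> (V - F) = V" using F by blast
        ultimately show ?thesis using F by (simp add: dist_real_def)
      qed
      finally have hd: "(l2_norm V h)\<^sup>2 \<le> d" .
      have "(l2_norm V (T f))\<^sup>2 \<le> (C * l2_norm V h)\<^sup>2"
        using C(2)[OF h] \<open>T h = T f\<close> by (intro power_mono) auto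
      also have "\<dots> \<le> C\<^sup>2 * d"
        using hd by (simp add: power_mult_distrib mult_left_mono)
      also have "\<dots> \<le> (C\<^sup>2 + 1) * d" using d by (simp add: algebra_simps)
      also have "\<dots> = e" by (simp add: d_def) (smt (verit) zero_le_power2)
      finally show ?thesis .
    qed
    then have "(l2_norm V (T f))\<^sup>2 \<le> 0" by (rule field_le_epsilon) simp
    then show ?thesis
      using l2_norm_eq_0D[OF bounded_opsD(1)[OF T f]] by (simp add: op_zero_def)
  qed
qed

subsection \<open>Finitely supported kernels\<close>

lemma kernel_op_apply:
  assumes "f \<in> l2 V" "x \<in> V" "finite N" "N \<subseteq> V" "\<And>y. y \<in> V \<Longrightarrow> y \<notin> N \<Longrightarrow> K x y = 0"
  shows "kernel_op V K f x = (\<Sum>y\<in>N. K x y * f y)"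
proof -
  have "(\<Sum>\<^sub>\<infinity>y\<in>V. K x y * f y) = (\<Sum>\<^sub>\<infinity>y\<in>N. K x y * f y)"
    by (rule infsum_cong_neutral) (use assms in auto)
  then show ?thesis using assms by (simp add: kernel_op_def)
qed

text \<open>Each row has at most \<open>card E\<close> nonzero entries, so Cauchy-Schwarz bounds the
  square of a value of the image by a finite sum of squares. Summing over \<open>V\<close> preserves
  the norm of \<open>f\<close> in each term, as every \<open>\<sigma> g\<close> permutes
  \<open>V\<close>; the resulting bound is \<open>card E * C\<close>.\<close>

lemma kernel_op_bounded:
  fixes \<sigma> :: "'g \<Rightarrow> 'v \<Rightarrow> 'v"
  assumes E: "finite E" and bij: "\<And>g. g \<in> E \<Longrightarrow> bij_betw (\<sigma> g) V V"
    and supp: "\<And>x y. x \<in> V \<Longrightarrow> y \<in> V \<Longrightarrow> K x y \<noteq> 0 \<Longrightarrow> \<exists>g\<in>E. y = \<sigma> g x"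
    and bd: "\<And>x y. x \<in> V \<Longrightarrow> y \<in> V \<Longrightarrow> cmod (K x y) \<le> C"
  shows "kernel_op V K \<in> bounded_ops V"
\<comment> \<open>Over an empty \<open>V\<close> the hypothesis on \<open>C\<close> is vacuous and
  \<open>C\<close> could be negative.\<close>
proof (cases "V = {}")
  case True
  then have "l2 V = {\<lambda>x. 0}" by (auto simp: l2_def)
  then show ?thesis using True by (auto simp: bounded_ops_def kernel_op_def)
next
  case False
  \<comment> \<open>As an image set, \<open>N x\<close> counts a vertex once even if several
    \<open>g\<close> reach it. The sum over \<open>E\<close> that replaces it later may count it
    repeatedly, which only enlarges a sum of nonnegative terms.\<close>
  define N where "N x = (\<lambda>g. \<sigma> g x) ` E" for x
  have N: "finite (N x)" "N x \<subseteq> V" if "x \<in> V" for x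
    using E bij that by (auto simp: N_def bij_betw_def)
  have app: "kernel_op V K f x = (\<Sum>y\<in>N x. K x y * f y)" if "f \<in> l2 V" "x \<in> V" for f x
    by (rule kernel_op_apply[OF that N]) (use that supp in \<open>auto simp: N_def\<close>)
  have out: "kernel_op V K f x = 0" if "x \<notin> V" for f x using that by (simp add: kernel_op_def)
  have C0: "0 \<le> C" using bd False norm_ge_zero order_trans by (metis all_not_in_conv)
  let ?M = "real (card E) * C\<^sup>2"
  have sq: "(cmod (kernel_op V K f x))\<^sup>2 \<le> ?M * (\<Sum>g\<in>E. (cmod (f (\<sigma> g x)))\<^sup>2)"
    if "f \<in> l2 V" "x \<in> V" for f x
  proof -
    have "cmod (kernel_op V K f x) \<le> (\<Sum>y\<in>N x. cmod (K x y * f y))"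
      unfolding app[OF that] by (rule norm_sum)
    also have "\<dots> \<le> (\<Sum>y\<in>N x. C * cmod (f y))"
      using that N(2) bd by (intro sum_mono) (auto simp: norm_mult intro!: mult_right_mono)
    also have "\<dots> \<le> (\<Sum>g\<in>E. C * cmod (f (\<sigma> g x)))"
      using sum_image_le[OF E, of "\<lambda>y. C * cmod (f y)" "\<lambda>g. \<sigma> g x"] C0
      unfolding N_def by (simp add: o_def)
    finally have "(cmod (kernel_op V K f x))\<^sup>2 \<le> (\<Sum>g\<in>E. C * cmod (f (\<sigma> g x)))\<^sup>2"
      by (intro power_mono) auto
    also have "\<dots> \<le> (\<Sum>g\<in>E. (C * cmod (f (\<sigma> g x)))\<^sup>2) * real (card E)"
      using sum_squared_le_sum_of_squares by blast
    finally show ?thesis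
      by (simp add: power_mult_distrib sum_distrib_left[symmetric] algebra_simps)
  qed
  have hs: "((\<lambda>x. ?M * (\<Sum>g\<in>E. (cmod (f (\<sigma> g x)))\<^sup>2)) has_sum
      (?M * (\<Sum>g\<in>E. (l2_norm V f)\<^sup>2))) V" if "f \<in> l2 V" for f
  proof (rule has_sum_cmult_right)
    have one: "((\<lambda>x. (cmod (f (\<sigma> g x)))\<^sup>2) has_sum (l2_norm V f)\<^sup>2) V" if "g \<in> E" for g
      using has_sum_reindex_bij_betw[OF bij[OF that], of "\<lambda>x. (cmod (f x))\<^sup>2"]
        has_sum_infsum[OF l2_summable[OF \<open>f \<in> l2 V\<close>]] by (simp add: l2_norm_square)
    show "((\<lambda>x. \<Sum>g\<in>E. (cmod (f (\<sigma> g x)))\<^sup>2) has_sum (\<Sum>g\<in>E. (l2_norm V f)\<^sup>2)) V"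
      using E one
    proof (induction E rule: finite_induct)
      case (insert g E)
      then show ?case
        using has_sum_add[of "\<lambda>x. (cmod (f (\<sigma> g x)))\<^sup>2"] by (simp del: sum_constant)
    qed simp
  qed
  have l2: "kernel_op V K f \<in> l2 V"
    and le: "(l2_norm V (kernel_op V K f))\<^sup>2 \<le> ?M * (\<Sum>g\<in>E. (l2_norm V f)\<^sup>2)"
    if "f \<in> l2 V" for f
    using l2_majorized[OF out has_sum_imp_summable[OF hs[OF that]] sq[OF that]]
      infsumI[OF hs[OF that]] by simp_all
  have "l2_norm V (kernel_op V K f) \<le> (real (card E) * C) * l2_norm V f" if "f \<in> l2 V" for f
  proof (rule power2_le_imp_le)
    show "(l2_norm V (kernel_op V K f))\<^sup>2 \<le> (real (card E) * C * l2_norm V f)\<^sup>2"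
      using le[OF that] by (simp add: power_mult_distrib power2_eq_square mult_ac)
  qed (use C0 in simp)
  moreover have "kernel_op V K (\<lambda>x. f x + g x) = (\<lambda>x. kernel_op V K f x + kernel_op V K g x)"
    if "f \<in> l2 V" "g \<in> l2 V" for f g
  proof
    fix x show "kernel_op V K (\<lambda>x. f x + g x) x = kernel_op V K f x + kernel_op V K g x"
      using that by (cases "x \<in> V")
        (simp_all add: out app l2_add sum.distrib algebra_simps)
  qed
  moreover have "kernel_op V K (\<lambda>x. c * f x) = (\<lambda>x. c * kernel_op V K f x)"
    if "f \<in> l2 V" for f c
  proof
    fix x show "kernel_op V K (\<lambda>x. c * f x) x = c * kernel_op V K f x"
      using that by (cases "x \<in> V")
        (simp_all add: out app l2_scale sum_distrib_left algebra_simps)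
  qed
  moreover have "kernel_op V K f = (\<lambda>x. 0)" if "f \<notin> l2 V" for f
    using that by (simp add: kernel_op_def)
  ultimately show ?thesis using l2 by (auto simp: bounded_ops_def)
qed

section \<open>Coordinate projections\<close>

definition coord_kernel :: "'v set \<Rightarrow> 'v \<Rightarrow> 'v \<Rightarrow> complex"
  where "coord_kernel U = (\<lambda>x y. if x \<in> U \<and> y = x then 1 else 0)"

text \<open>Multiplication by the indicator function of \<open>U\<close>, given as a kernel operator
  so that the criteria for local kernels apply to it.\<close>

definition coord_proj :: "'v set \<Rightarrow> 'v set \<Rightarrow> 'v operator"
  where "coord_proj V U = kernel_op V (coord_kernel U)"

lemma coord_proj_bounded: "coord_proj V U \<in> bounded_ops V"
  unfolding coord_proj_def
  by (rule kernel_op_bounded[of "{()}" "\<lambda>_ x. x" _ _ 1]) (auto simp: coord_kernel_def bij_betw_def split: if_splits)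

lemma coord_proj_apply:
  assumes "f \<in> l2 V"
  shows "coord_proj V U f = (\<lambda>x. if x \<in> U then f x else 0)"
proof
  fix x
  show "coord_proj V U f x = (if x \<in> U then f x else 0)"
  proof (cases "x \<in> V")
    case True
    then show ?thesis unfolding coord_proj_def
      by (subst kernel_op_apply[OF assms True, of "{x}"]) (auto simp: coord_kernel_def)
  next
    case False
    then show ?thesis using assms by (simp add: coord_proj_def kernel_op_def l2_outside)
  qed
qed

lemma coord_proj_norm:
  assumes "f \<in> l2 V"
  shows "l2_norm V (coord_proj V U f) \<le> l2_norm V f"
  using l2_dominated(2)[OF assms, of 1 "coord_proj V U f"] by (simp add: coord_proj_apply[OF assms])

lemma coord_proj_outside: "f \<notin> l2 V \<Longrightarrow> coord_proj V U f = (\<lambda>x. 0)"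
  by (simp add: coord_proj_def kernel_op_def)

lemma coord_proj_comp: "coord_proj V U \<circ> coord_proj V W = coord_proj V (U \<inter> W)"
proof
  fix f show "(coord_proj V U \<circ> coord_proj V W) f = coord_proj V (U \<inter> W) f"
  proof (cases "f \<in> l2 V")
    case True
    with bounded_opsD(1)[OF coord_proj_bounded True] show ?thesis
      by (auto simp: coord_proj_apply)
  next
    case False
    then show ?thesis
      by (simp add: coord_proj_outside bounded_ops_zero[OF coord_proj_bounded])
  qed
qed

subsection \<open>Ideals\<close>

lemma ideal_op_diff:
  assumes "closed_two_sided_ideal V A I" "S \<in> I" "T \<in> I"
  shows "op_diff S T \<in> I"
proof -
  have "op_diff S T = op_add S (op_scale (-1) T)"
    by (auto simp: op_diff_def op_add_def op_scale_def)
  then show ?thesis using assms by (simp add: closed_two_sided_ideal_def)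
qed

text \<open>With \<open>N = P - S\<close> of norm at most \<open>r < 1\<close>, the operators \<open>P - N\<^sup>n\<close> lie in the ideal and tend
  to \<open>P\<close>; the recursion \<open>J\<^sub>n\<^sub>+\<^sub>1 = J\<^sub>n + S - J\<^sub>n S\<close> for \<open>J\<^sub>n = P - N\<^sup>n\<close> shows membership.\<close>

lemma idempotent_in_ideal:
  assumes ideal: "closed_two_sided_ideal V A I" and A: "A \<subseteq> bounded_ops V"
    and P: "P \<in> bounded_ops V" and S: "S \<in> I"
    and PS: "P \<circ> S = S" and SP: "S \<circ> P = S" and PP: "P \<circ> P = P"
    and contr: "\<And>f. f \<in> l2 V \<Longrightarrow> l2_norm V (P f) \<le> l2_norm V f"
    and near: "\<And>f. f \<in> l2 V \<Longrightarrow> l2_norm V (op_diff P S f) \<le> r * l2_norm V f"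
    and r: "0 \<le> r" "r < 1"
  shows "P \<in> I"
proof -
  define J where "J = rec_nat op_zero (\<lambda>_ J. op_diff (op_add J S) (J \<circ> S))"
  have J0: "J 0 = op_zero" and JS: "J (Suc n) = op_diff (op_add (J n) S) (J n \<circ> S)" for n
    by (simp_all add: J_def)
  have I: "I \<subseteq> A" "op_zero \<in> I" and add: "\<And>S T. S \<in> I \<Longrightarrow> T \<in> I \<Longrightarrow> op_add S T \<in> I"
    and mult: "\<And>S T. T \<in> A \<Longrightarrow> S \<in> I \<Longrightarrow> T \<circ> S \<in> I" and closed: "norm_closure V I = I"
    using ideal by (auto simp: closed_two_sided_ideal_def)
  have JI: "J n \<in> I" for n
  proof (induction n)
    case (Suc n)
    then show ?case unfolding JS using I S by (intro ideal_op_diff[OF ideal] add mult) auto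
  qed (simp add: J0 I)
  have JP: "J n (P f) = J n f" for n f
  proof (induction n)
    case (Suc n)
    then show ?case using fun_cong[OF SP, of f] by (simp add: JS op_diff_def op_add_def)
  qed (simp add: J0 op_zero_def)
  have le: "l2_norm V (op_diff P (J n) f) \<le> r ^ n * l2_norm V f" if "f \<in> l2 V" for n f
    using that
  proof (induction n arbitrary: f)
    case 0
    \<comment> \<open>Here \<open>N\<^sup>0\<close> is read as \<open>P\<close>, which is a
      contraction by \<open>contr\<close>.\<close>
    then show ?case using contr by (simp add: J0 op_diff_def op_zero_def)
  next
    case (Suc n)
    have Jb: "J n \<in> bounded_ops V" and Sb: "S \<in> bounded_ops V" using JI S I A by blast+
    have Pf: "P f \<in> l2 V" and Sf: "S f \<in> l2 V"
      using P Sb Suc.prems bounded_opsD(1) by blast+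
    have Nf: "op_diff P S f \<in> l2 V"
      unfolding op_diff_def by (rule l2_diff(1)[OF Pf Sf])
    \<comment> \<open>This is \<open>(P - J n) (P - S) = P - J (Suc n)\<close>, expanded with
      \<open>P P = P\<close>, \<open>P S = S\<close> and \<open>J n P = J n\<close>.\<close>
    have "op_diff P (J n) (op_diff P S f) = op_diff P (J (Suc n)) f"
      unfolding op_diff_def JS op_add_def bounded_ops_diff[OF P Pf Sf] bounded_ops_diff[OF Jb Pf Sf]
      using fun_cong[OF PP, of f] fun_cong[OF PS, of f] JP by auto
    then have "l2_norm V (op_diff P (J (Suc n)) f) \<le> r ^ n * l2_norm V (op_diff P S f)"
      using Suc.IH[OF Nf] by simp
    also have "\<dots> \<le> r ^ n * (r * l2_norm V f)"
      by (intro mult_left_mono near Suc.prems) (use r in auto)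
    finally show ?case by (simp add: mult_ac)
  qed
  have "\<exists>S\<in>I. op_norm V (op_diff P S) < e" if e: "e > 0" for e
  proof -
    obtain n where n: "r ^ n < e" using real_arch_pow_inv[OF e r(2)] by blast
    have "op_norm V (op_diff P (J n)) \<le> r ^ n"
      by (rule op_norm_le) (use r le in auto)
    then show ?thesis using n JI[of n] by (meson le_less_trans)
  qed
  then have "P \<in> norm_closure V I" using P by (simp add: norm_closure_def)
  then show ?thesis using closed by simp
qed

text \<open>A union of two sets has the projection
  \<open>P\<^sub>U + P\<^sub>W - P\<^sub>U P\<^sub>W\<close>, and the product stays in the
  ideal.\<close>

lemma ideal_coord_proj_Union:
  assumes ideal: "closed_two_sided_ideal V A I" and "finite \<U>"
    and "\<And>U. U \<in> \<U> \<Longrightarrow> coord_proj V U \<in> I"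
  shows "coord_proj V (\<Union>\<U>) \<in> I"
  using assms(2,3)
proof (induction \<U> rule: finite_induct)
  case empty
  have "coord_proj V {} f = op_zero f" for f
    by (cases "f \<in> l2 V") (simp_all add: coord_proj_apply coord_proj_outside op_zero_def)
  then have "coord_proj V {} = op_zero" by blast
  then show ?case using ideal by (simp add: closed_two_sided_ideal_def)
next
  case (insert U \<U>)
  let ?W = "\<Union>\<U>"
  have "coord_proj V (\<Union>(insert U \<U>)) f
      = op_diff (op_add (coord_proj V U) (coord_proj V ?W)) (coord_proj V (U \<inter> ?W)) f" for f
    by (cases "f \<in> l2 V")
      (auto simp: coord_proj_apply coord_proj_outside op_diff_def op_add_def)
  then have eq: "coord_proj V (\<Union>(insert U \<U>))
      = op_diff (op_add (coord_proj V U) (coord_proj V ?W)) (coord_proj V U \<circ> coord_proj V ?W)"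
    unfolding coord_proj_comp by blast
  have "coord_proj V U \<in> I" "coord_proj V ?W \<in> I" using insert by auto
  then show ?case
    unfolding eq using ideal
    by (intro ideal_op_diff[OF ideal]) (auto simp: closed_two_sided_ideal_def)
qed

text \<open>\<open>coord_proj V V\<close> acts as a unit: it fixes \<open>l2 V\<close> and, like
  every bounded operator here, sends everything else to 0.\<close>

lemma ideal_eq_algebraI:
  assumes "closed_two_sided_ideal V A I" "A \<subseteq> bounded_ops V" "coord_proj V V \<in> I"
  shows "I = A"
proof
  show "I \<subseteq> A" using assms by (simp add: closed_two_sided_ideal_def)
  show "A \<subseteq> I"
  proof
    fix T assume T: "T \<in> A"
    then have b: "T \<in> bounded_ops V" using assms by blast
    have "(T \<circ> coord_proj V V) f = T f" for f
    proof (cases "f \<in> l2 V")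
      case True
      then have "coord_proj V V f = f" by (auto simp: coord_proj_apply l2_outside)
      then show ?thesis by simp
    next
      case False
      then show ?thesis by (simp add: coord_proj_outside bounded_ops_zero[OF b] bounded_opsD(4)[OF b])
    qed
    then have "T \<circ> coord_proj V V = T" by blast
    moreover have "T \<circ> coord_proj V V \<in> I"
      using assms(1,3) T by (simp add: closed_two_sided_ideal_def)
    ultimately show "T \<in> I" by simp
  qed
qed

section \<open>Local kernels in terms of stabilizers\<close>

locale schreier_graph = group G for G (structure) +
  fixes Q H
  assumes finite_gens: "finite Q" and gens_closed: "Q \<subseteq> carrier G"
    and generated: "generate G Q = carrier G" and H: "subgroup H G"
begin

section \<open>The action of the group on cosets\<close>

abbreviation V :: "'a set set" where "V \<equiv> lcosets H"

lemma coset_subset: "x \<in> V \<Longrightarrow> x \<subseteq> carrier G"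
  using lcosets_subset_PowG[OF H] by blast

lemma act_mult: "g \<in> carrier G \<Longrightarrow> h \<in> carrier G \<Longrightarrow> x \<in> V \<Longrightarrow> g <# (h <# x) = (g \<otimes> h) <# x"
  by (rule lcos_m_assoc[OF coset_subset])

lemma act_one: "x \<in> V \<Longrightarrow> \<one> <# x = x"
  by (rule lcos_mult_one[OF coset_subset])

lemma coset_cases:
  assumes "x \<in> V"
  obtains a where "a \<in> carrier G" "x = a <# H"
  using assms by (auto simp: LCOSETS_def)

lemma coset_in: "a \<in> carrier G \<Longrightarrow> a <# H \<in> V"
  by (auto simp: LCOSETS_def)

lemma base_in: "H \<in> V"
  using coset_in[OF one_closed] lcos_mult_one[OF subgroup.subset[OF H]] by simp

lemma act_closed [simp]: "g \<in> carrier G \<Longrightarrow> x \<in> V \<Longrightarrow> g <# x \<in> V"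
  by (erule coset_cases) (simp add: lcos_m_assoc[OF subgroup.subset[OF H]] coset_in)

text \<open>Coincidence of two translates of a vertex is a condition on its stabilizer; the
  dictionary between balls and stabilizers rests on this.\<close>

lemma act_eq_iff:
  assumes "g \<in> carrier G" "h \<in> carrier G" "x \<in> V"
  shows "g <# x = h <# x \<longleftrightarrow> (inv h \<otimes> g) <# x = x"
proof
  assume "g <# x = h <# x"
  then have "inv h <# (g <# x) = inv h <# (h <# x)" by simp
  then show "(inv h \<otimes> g) <# x = x" using assms by (simp add: act_mult act_one)
next
  assume "(inv h \<otimes> g) <# x = x"
  then have "h <# ((inv h \<otimes> g) <# x) = h <# x" by simp
  then show "g <# x = h <# x" using assms by (simp add: act_mult m_assoc[symmetric])
qed

lemma act_inv: "g \<in> carrier G \<Longrightarrow> x \<in> V \<Longrightarrow> inv g <# (g <# x) = x" "g \<in> carrier G \<Longrightarrow> x \<in> V \<Longrightarrow> g <# (inv g <# x) = x"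
  by (simp_all add: act_mult act_one)

lemma act_bij: "g \<in> carrier G \<Longrightarrow> bij_betw (l_coset G g) V V"
  by (rule bij_betw_byWitness[where f' = "l_coset G (inv g)"]) (auto simp: act_inv)

lemma act_transitive:
  assumes "x \<in> V" "y \<in> V"
  obtains g where "g \<in> carrier G" "y = g <# x"
proof -
  obtain a b where a: "a \<in> carrier G" "x = a <# H" and b: "b \<in> carrier G" "y = b <# H"
    using assms coset_cases by metis
  have "y = (b \<otimes> inv a) <# x"
    using a b lcos_m_assoc[OF subgroup.subset[OF H]] by (simp add: m_assoc)
  then show ?thesis using that[of "b \<otimes> inv a"] a b by simp
qed

section \<open>Word length and distance in the Schreier graph\<close>

definition syms :: "'a set" where "syms = Q \<union> m_inv G ` Q"

lemma syms_closed: "s \<in> syms \<Longrightarrow> s \<in> carrier G"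
  using gens_closed by (auto simp: syms_def)

lemma inv_syms: "s \<in> syms \<Longrightarrow> inv s \<in> syms"
  using gens_closed by (auto simp: syms_def subset_iff)

text \<open>The ball of the Cayley graph; applied to a vertex it sweeps out the ball of the Schreier
  graph. Words grow on the left because edges act by left multiplication.\<close>

primrec word_ball :: "nat \<Rightarrow> 'a set" where
  "word_ball 0 = {\<one>}"
| "word_ball (Suc n) = word_ball n \<union> (\<lambda>(s, w). s \<otimes> w) ` (syms \<times> word_ball n)"

lemma word_ball_closed: "w \<in> word_ball n \<Longrightarrow> w \<in> carrier G"
  by (induction n arbitrary: w) (auto simp: syms_closed)

lemma finite_word_ball: "finite (word_ball n)"
  using finite_gens by (induction n) (auto simp: syms_def)

lemma one_word_ball [simp]: "\<one> \<in> word_ball n"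
  by (induction n) auto

lemma word_ball_Suc: "s \<in> syms \<Longrightarrow> w \<in> word_ball n \<Longrightarrow> s \<otimes> w \<in> word_ball (Suc n)"
  by auto

lemma word_ball_mono: "m \<le> n \<Longrightarrow> word_ball m \<subseteq> word_ball n"
  by (rule lift_Suc_mono_le[of word_ball]) auto

lemma word_ball_mult: "v \<in> word_ball m \<Longrightarrow> w \<in> word_ball n \<Longrightarrow> v \<otimes> w \<in> word_ball (m + n)"
proof (induction m arbitrary: v)
  case 0
  then show ?case by (simp add: word_ball_closed)
next
  case (Suc m)
  from Suc.prems(1) consider "v \<in> word_ball m"
    | s u where "s \<in> syms" "u \<in> word_ball m" "v = s \<otimes> u" by auto
  then show ?case
  proof cases
    case 1
    then show ?thesis using Suc by simp
  next
    case 2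
    then have "v \<otimes> w = s \<otimes> (u \<otimes> w)"
      using Suc.prems by (simp add: m_assoc syms_closed word_ball_closed)
    then show ?thesis using 2 Suc word_ball_Suc by simp
  qed
qed

lemma word_ball_inv: "w \<in> word_ball n \<Longrightarrow> inv w \<in> word_ball n"
proof (induction n arbitrary: w)
  case (Suc n)
  from Suc.prems consider "w \<in> word_ball n"
    | s u where "s \<in> syms" "u \<in> word_ball n" "w = s \<otimes> u" by auto
  then show ?case
  proof cases
    case 1
    then show ?thesis using Suc by simp
  next
    case 2
    then have "inv w = inv u \<otimes> inv s"
      by (simp add: inv_mult_group syms_closed word_ball_closed)
    moreover have "inv s \<in> word_ball 1"
      using word_ball_Suc[OF inv_syms[OF 2(1)], of \<one> 0] 2 by (simp add: syms_closed)
    ultimately show ?thesis using word_ball_mult[OF Suc.IH[OF 2(2)], of "inv s" 1] by simp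
  qed
qed simp

lemma in_some_word_ball: "g \<in> carrier G \<Longrightarrow> \<exists>n. g \<in> word_ball n"
proof -
  assume "g \<in> carrier G"
  then have "g \<in> generate G Q" using generated by simp
  then show ?thesis
  proof (induction rule: generate.induct)
    case one
    then show ?case by auto
  next
    case (incl h)
    then have "h \<in> syms" by (simp add: syms_def)
    then show ?case using word_ball_Suc[of h \<one> 0] by (metis one_word_ball r_one syms_closed)
  next
    case (inv h)
    then have "inv h \<in> syms" by (simp add: syms_def)
    then show ?case using word_ball_Suc[of "inv h" \<one> 0] by (metis one_word_ball r_one syms_closed)
  next
    case (eng h1 h2)
    then show ?case using word_ball_mult by blast
  qed
qed

lemma finite_subset_word_ball:
  assumes "finite F" "F \<subseteq> carrier G"
  obtains n where "F \<subseteq> word_ball n"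
  using assms
proof (induction F arbitrary: thesis rule: finite_induct)
  case (insert g F)
  obtain n where n: "F \<subseteq> word_ball n" using insert by auto
  obtain m where m: "g \<in> word_ball m" using in_some_word_ball insert.prems by blast
  show ?case
    using insert.prems(1)[of "max m n"] n m word_ball_mono[of m "max m n"]
      word_ball_mono[of n "max m n"] by auto
qed simp

lemma schreier_edge_iff:
  "schreier_edge G Q H s u v \<longleftrightarrow> u \<in> V \<and> v \<in> V \<and> s \<in> syms \<and> s <# u = v"
proof -
  have "\<gamma> <# v = u \<longleftrightarrow> inv \<gamma> <# u = v" if "\<gamma> \<in> Q" "u \<in> V" "v \<in> V" for \<gamma>
    using that gens_closed by (metis act_inv subsetD)
  then show ?thesis unfolding schreier_edge_def syms_def by blast
qed

abbreviation edges :: "('a set \<times> 'a set) set"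
  where "edges \<equiv> {(u, v). \<exists>s. schreier_edge G Q H s u v}"

lemma relpow_edgesD: "(x, y) \<in> edges ^^ n \<Longrightarrow> x \<in> V \<Longrightarrow> \<exists>w\<in>word_ball n. y = w <# x"
proof (induction n arbitrary: y)
  case 0
  then show ?case by (simp add: act_one)
next
  case (Suc n)
  then obtain u where u: "(x, u) \<in> edges ^^ n" "(u, y) \<in> edges" by (auto elim: relpow_Suc_E)
  obtain w where "w \<in> word_ball n" "u = w <# x" using Suc.IH[OF u(1) Suc.prems(2)] by blast
  moreover obtain s where "s \<in> syms" "s <# u = y"
    using u(2) unfolding schreier_edge_iff by blast
  ultimately have "s \<otimes> w \<in> word_ball (Suc n)" "y = (s \<otimes> w) <# x"
    using word_ball_Suc Suc.prems(2) by (auto simp: act_mult syms_closed word_ball_closed)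
  then show ?case by blast
qed

text \<open>The path may be shorter than \<open>n\<close>, since \<open>word_ball n\<close> also
  contains the shorter words.\<close>

lemma relpow_edgesI: "w \<in> word_ball n \<Longrightarrow> x \<in> V \<Longrightarrow> \<exists>k\<le>n. (x, w <# x) \<in> edges ^^ k"
proof (induction n arbitrary: w)
  case 0
  then show ?case by (simp add: act_one)
next
  case (Suc n)
  from Suc.prems(1) consider "w \<in> word_ball n"
    | s u where "s \<in> syms" "u \<in> word_ball n" "w = s \<otimes> u" by auto
  then show ?case
  proof cases
    case 1
    then show ?thesis using Suc le_SucI by blast
  next
    case 2
    obtain k where k: "k \<le> n" "(x, u <# x) \<in> edges ^^ k" using Suc 2 by blast
    have "(u <# x, w <# x) \<in> edges"
      using 2 Suc.prems(2) by (auto simp: schreier_edge_iff act_mult syms_closed word_ball_closed)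
    then show ?thesis using k by (intro exI[of _ "Suc k"]) auto
  qed
qed

lemma schreier_dist_le_iff:
  assumes "x \<in> V" "y \<in> V"
  shows "schreier_dist G Q H x y \<le> n \<longleftrightarrow> (\<exists>w\<in>word_ball n. y = w <# x)"
proof
  \<comment> \<open>The \<open>LEAST\<close> in \<open>schreier_dist\<close> is under control only
    once some path exists; transitivity and generation by \<open>Q\<close> supply one.\<close>
  obtain g where "g \<in> carrier G" "y = g <# x" using act_transitive[OF assms] .
  then obtain k where "(x, y) \<in> edges ^^ k"
    using in_some_word_ball relpow_edgesI[OF _ assms(1)] by metis
  then have "(x, y) \<in> edges ^^ schreier_dist G Q H x y"
    unfolding schreier_dist_def by (rule LeastI)
  then have "\<exists>w\<in>word_ball (schreier_dist G Q H x y). y = w <# x"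
    using relpow_edgesD assms(1) by blast
  then show "schreier_dist G Q H x y \<le> n \<Longrightarrow> \<exists>w\<in>word_ball n. y = w <# x"
    using word_ball_mono by blast
next
  assume "\<exists>w\<in>word_ball n. y = w <# x"
  then obtain k where "k \<le> n" "(x, y) \<in> edges ^^ k"
    using relpow_edgesI[OF _ assms(1)] by blast
  then show "schreier_dist G Q H x y \<le> n"
    unfolding schreier_dist_def using Least_le[of "\<lambda>n. (x, y) \<in> edges ^^ n" k] by simp
qed

lemma schreier_ball_eq:
  assumes "x \<in> V"
  shows "schreier_ball G Q H n x = (\<lambda>w. w <# x) ` word_ball n"
  using assms schreier_dist_le_iff[OF assms] word_ball_closed
  unfolding schreier_ball_def by auto

section \<open>Local kernels seen through finite windows of stabilizers\<close>

definition same_stab :: "'a set \<Rightarrow> 'a set \<Rightarrow> 'a set \<Rightarrow> bool"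
  where "same_stab F y z \<longleftrightarrow> (\<forall>g\<in>F. g <# y = y \<longleftrightarrow> g <# z = z)"

text \<open>\<open>E\<close> bounds the displacement of the kernel, and \<open>F\<close> is the
  window through which a row sees the stabilizer of its vertex. For finite \<open>E\<close> and
  \<open>F\<close> in the group these are exactly the local kernels, with ball isomorphisms
  eliminated.\<close>

definition stab_local :: "'a set \<Rightarrow> 'a set \<Rightarrow> ('a set \<Rightarrow> 'a set \<Rightarrow> complex) \<Rightarrow> bool"
  where "stab_local E F K \<longleftrightarrow>
    (\<forall>x\<in>V. \<forall>y\<in>V. K x y \<noteq> 0 \<longrightarrow> (\<exists>g\<in>E. y = g <# x)) \<and>
    (\<forall>y\<in>V. \<forall>z\<in>V. same_stab F y z \<longrightarrow> (\<forall>g\<in>E. K y (g <# y) = K z (g <# z)))"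

text \<open>A vertex has at most one outgoing edge with a given label, so a map that respects the
  root and the labels is forced along every path from the root that stays in the ball.\<close>

lemma ball_iso_act:
  assumes "ball_iso G Q H R y z \<theta>" "y \<in> V" "z \<in> V"
  shows "n \<le> R \<Longrightarrow> w \<in> word_ball n \<Longrightarrow> \<theta> (w <# y) = w <# z"
proof (induction n arbitrary: w)
  case 0
  then show ?case using assms by (simp add: act_one ball_iso_def)
next
  case (Suc n)
  from Suc.prems(2) consider "w \<in> word_ball n"
    | s u where "s \<in> syms" "u \<in> word_ball n" "w = s \<otimes> u" by auto
  then show ?case
  proof cases
    case 1
    then show ?thesis using Suc by simp
  next
    case 2
    have b: "u <# y \<in> schreier_ball G Q H R y" "w <# y \<in> schreier_ball G Q H R y"
      using 2 Suc.prems word_ball_mono[of n R] word_ball_mono[of "Suc n" R]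
      by (auto simp: schreier_ball_eq assms(2))
    have "schreier_edge G Q H s (u <# y) (w <# y)"
      using 2 assms(2) by (simp add: schreier_edge_iff act_mult syms_closed word_ball_closed)
    then have "schreier_edge G Q H s (\<theta> (u <# y)) (\<theta> (w <# y))"
      using b assms(1) by (simp add: ball_iso_def)
    then have "\<theta> (w <# y) = s <# (u <# z)"
      using 2 Suc by (simp add: schreier_edge_iff)
    then show ?thesis using 2 assms(3) by (simp add: act_mult syms_closed word_ball_closed)
  qed
qed

text \<open>A ball isomorphism takes \<open>v <# y\<close> to \<open>v <# z\<close>, and by
  injectivity the same short words fix \<open>y\<close> and \<open>z\<close>. A radius that covers
  \<open>E\<close> and \<open>F\<close> therefore suffices.\<close>

lemma stab_local_imp_local_kernel:
  assumes K: "stab_local E F K" and fin: "finite E" "finite F" "E \<subseteq> carrier G" "F \<subseteq> carrier G"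
  shows "local_kernel G Q H K"
proof -
  obtain n where "E \<union> F \<subseteq> word_ball n" using finite_subset_word_ball[of "E \<union> F"] fin by auto
  \<comment> \<open>Passing from \<open>n\<close> to \<open>Suc n\<close> makes the radius positive,
    as \<open>local_kernel\<close> demands.\<close>
  then obtain R where R: "R > 0" "E \<subseteq> word_ball R" "F \<subseteq> word_ball R"
    using word_ball_mono[of n "Suc n"] by (metis le_Suc_eq le_sup_iff order.trans zero_less_Suc order_refl)
  have 1: "K x y = 0" if "x \<in> V" "y \<in> V" "schreier_dist G Q H x y > R" for x y
    using that K R schreier_dist_le_iff[OF that(1,2), of R] unfolding stab_local_def
    by (meson leD subsetD)
  have 2: "K y w = K z (\<theta> w)"
    if yz: "y \<in> V" "z \<in> V" and iso: "ball_iso G Q H R y z \<theta>"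
      and w: "w \<in> schreier_ball G Q H R y" for y z \<theta> w
  proof -
    have \<theta>: "\<theta> (v <# y) = v <# z" if "v \<in> word_ball R" for v
      using ball_iso_act[OF iso yz order_refl that] .
    have inj: "inj_on \<theta> (schreier_ball G Q H R y)"
      using iso by (simp add: ball_iso_def bij_betw_def)
    have ball: "v <# y \<in> schreier_ball G Q H R y" if "v \<in> word_ball R" for v
      using that yz by (simp add: schreier_ball_eq)
    have fix_iff: "v <# y = y \<longleftrightarrow> v <# z = z" if "v \<in> word_ball R" for v
      using inj_on_eq_iff[OF inj ball[OF that] ball[OF one_word_ball]] \<theta>[OF that]
        \<theta>[OF one_word_ball] yz by (simp add: act_one)
    have stab: "same_stab F y z" using R fix_iff by (auto simp: same_stab_def)
    show ?thesis
    proof (cases "\<exists>g\<in>E. w = g <# y")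
      case True
      then show ?thesis using K stab yz \<theta> R by (auto simp: stab_local_def subset_iff)
    next
      case False
      obtain v where v: "v \<in> word_ball R" "w = v <# y" using w yz by (auto simp: schreier_ball_eq)
      \<comment> \<open>A vertex that \<open>E\<close> does not reach from \<open>y\<close> goes to
        one that \<open>E\<close> does not reach from \<open>z\<close>, so both kernel values
        vanish.\<close>
      have "\<theta> w \<noteq> g <# z" if "g \<in> E" for g
      proof
        assume "\<theta> w = g <# z"
        then have "\<theta> w = \<theta> (g <# y)" using \<theta> that R by auto
        then have "w = g <# y" using inj_on_eq_iff[OF inj w ball] that R by auto
        then show False using False that by blast
      qed
      moreover have "\<theta> w \<in> V" using \<theta> v yz by (simp add: word_ball_closed)
      moreover have "w \<in> V" using v yz by (simp add: word_ball_closed)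
      ultimately show ?thesis using K False yz unfolding stab_local_def by metis
    qed
  qed
  show ?thesis unfolding local_kernel_def using R(1) 1 2 by (intro exI[of _ R]) blast
qed

text \<open>Conversely, if enough words fix \<open>y\<close> exactly when they fix \<open>z\<close>,
  then sending \<open>v <# y\<close> to \<open>v <# z\<close> is a well-defined ball
  isomorphism.\<close>

lemma local_kernel_imp_stab_local:
  assumes "local_kernel G Q H K"
  obtains E F where "finite E" "finite F" "E \<subseteq> carrier G" "F \<subseteq> carrier G" "stab_local E F K"
proof -
  obtain R where R0: "\<And>x y. x \<in> V \<Longrightarrow> y \<in> V \<Longrightarrow> schreier_dist G Q H x y > R \<Longrightarrow> K x y = 0"
    and R: "\<And>y z \<theta> w. y \<in> V \<Longrightarrow> z \<in> V \<Longrightarrow> ball_iso G Q H R y z \<theta> \<Longrightarrow>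
      w \<in> schreier_ball G Q H R y \<Longrightarrow> K y w = K z (\<theta> w)"
    using assms unfolding local_kernel_def by blast
  \<comment> \<open>An edge in the ball equates, at the root, a word of length at most
    \<open>Suc R\<close> with one of length at most \<open>R\<close>. By \<open>act_eq_iff\<close>
    this asks whether a word of length at most \<open>R + Suc R\<close> fixes the root.\<close>
  let ?B = "word_ball R" and ?F = "word_ball (R + Suc R)"
  have 1: "\<exists>g\<in>?B. y = g <# x" if "x \<in> V" "y \<in> V" "K x y \<noteq> 0" for x y
    using that R0 schreier_dist_le_iff by (meson not_le)
  have 2: "K y (g <# y) = K z (g <# z)"
    if yz: "y \<in> V" "z \<in> V" and stab: "same_stab ?F y z" and g: "g \<in> ?B" for y z g
  proof -
    have sub: "?B \<subseteq> word_ball (Suc R)" using word_ball_mono[of R "Suc R"] by simp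
    have eq: "v <# y = w <# y \<longleftrightarrow> v <# z = w <# z" if "v \<in> word_ball (Suc R)" "w \<in> ?B" for v w
    proof -
      have "inv w \<otimes> v \<in> ?F" by (intro word_ball_mult word_ball_inv that)
      then show ?thesis
        using stab yz that by (simp add: act_eq_iff word_ball_closed same_stab_def del: word_ball.simps)
    qed
    \<comment> \<open>Any short word that leads to \<open>u\<close> would do; \<open>eq\<close>
      makes the image independent of the choice.\<close>
    define \<theta> where "\<theta> u = (SOME w. w \<in> ?B \<and> w <# y = u) <# z" for u
    have \<theta>: "\<theta> (v <# y) = v <# z" if "v \<in> ?B" for v
    proof -
      have s: "(SOME w. w \<in> ?B \<and> w <# y = v <# y) \<in> ?B
          \<and> (SOME w. w \<in> ?B \<and> w <# y = v <# y) <# y = v <# y"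
        by (rule someI[of _ v]) (use that in simp)
      then show ?thesis unfolding \<theta>_def using eq[of v] that sub by (metis subsetD)
    qed
    have "ball_iso G Q H R y z \<theta>"
      unfolding ball_iso_def schreier_ball_eq[OF yz(1)] schreier_ball_eq[OF yz(2)]
    proof (intro conjI ballI allI)
      show "bij_betw \<theta> ((\<lambda>w. w <# y) ` ?B) ((\<lambda>w. w <# z) ` ?B)"
        unfolding bij_betw_def
      proof
        show "inj_on \<theta> ((\<lambda>w. w <# y) ` ?B)"
          using eq sub by (auto simp: inj_on_def \<theta> subset_iff)
        show "\<theta> ` (\<lambda>w. w <# y) ` ?B = (\<lambda>w. w <# z) ` ?B"
          by (auto simp: \<theta> image_image)
      qed
      show "\<theta> y = z" using \<theta>[OF one_word_ball] yz by (simp add: act_one)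
    next
      fix u v s assume "u \<in> (\<lambda>w. w <# y) ` ?B" "v \<in> (\<lambda>w. w <# y) ` ?B"
      then obtain a b where a: "a \<in> ?B" "u = a <# y" and b: "b \<in> ?B" "v = b <# y" by blast
      show "schreier_edge G Q H s u v \<longleftrightarrow> schreier_edge G Q H s (\<theta> u) (\<theta> v)"
        using eq[OF word_ball_Suc[OF _ a(1)] b(1), of s] a b yz
        by (auto simp: schreier_edge_iff \<theta> act_mult syms_closed word_ball_closed)
    qed
    moreover have "g <# y \<in> schreier_ball G Q H R y" using g yz by (auto simp: schreier_ball_eq)
    ultimately show ?thesis using R[OF yz, of \<theta> "g <# y"] \<theta> g by simp
  qed
  show ?thesis
    by (rule that[of ?B ?F])
      (use 1 2 word_ball_closed finite_word_ball in \<open>auto simp: stab_local_def simp del: word_ball.simps\<close>)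
qed

text \<open>The entry at \<open>(x, g <# x)\<close> depends only on \<open>g\<close> and on which
  elements of \<open>F\<close> fix \<open>x\<close>, so finitely many moduli occur.\<close>

lemma stab_local_bounded:
  assumes K: "stab_local E F K" and fin: "finite E" "finite F"  "E \<subseteq> carrier G"
  shows "kernel_op V K \<in> bounded_ops V"
proof -
  define pat where "pat x = {g \<in> F. g <# x = x}" for x
  \<comment> \<open>A pattern that no vertex realizes gets an arbitrary value, which at most
    enlarges the finite set \<open>M\<close>.\<close>
  define rep where "rep p = (SOME x. x \<in> V \<and> pat x = p)" for p
  define M where "M = (\<lambda>(p, g). cmod (K (rep p) (g <# rep p))) ` (Pow F \<times> E)"
  have M: "finite M" unfolding M_def using fin by simp
  have "K x (g <# x) = K (rep (pat x)) (g <# rep (pat x))" if "x \<in> V" "g \<in> E" for x g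
  proof -
    have "rep (pat x) \<in> V \<and> pat (rep (pat x)) = pat x"
      unfolding rep_def by (rule someI[of _ x]) (use that in simp)
    moreover from this have "same_stab F x (rep (pat x))" unfolding same_stab_def pat_def by blast
    ultimately show ?thesis using K that unfolding stab_local_def by blast
  qed
  then have in_M: "cmod (K x (g <# x)) \<in> M" if "x \<in> V" "g \<in> E" for x g
    using that by (auto simp: M_def pat_def image_iff intro!: bexI[of _ g] exI[of _ "pat x"])
  show ?thesis
  \<comment> \<open>The inserted 0 covers the zero entries and keeps the maximum defined when
    \<open>M\<close> is empty.\<close>
  proof (rule kernel_op_bounded[OF fin(1), where \<sigma> = "l_coset G" and C = "Max (insert 0 M)"])
    show "bij_betw (l_coset G g) V V" if "g \<in> E" for g using act_bij that fin by blast
    show supp: "\<exists>g\<in>E. y = g <# x" if "x \<in> V" "y \<in> V" "K x y \<noteq> 0" for x y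
      using K that by (auto simp: stab_local_def)
    show "cmod (K x y) \<le> Max (insert 0 M)" if xy: "x \<in> V" "y \<in> V" for x y
    proof (cases "K x y = 0")
      case False
      then obtain g where "g \<in> E" "y = g <# x" using supp xy by blast
      then show ?thesis using in_M xy M by (intro Max_ge) auto
    qed (use M in simp)
  qed
qed

lemma stab_local_in_cstar_r:
  assumes "stab_local E F K" "finite E" "finite F" "E \<subseteq> carrier G" "F \<subseteq> carrier G"
  shows "kernel_op V K \<in> cstar_r G Q H"
  unfolding cstar_r_def
  using stab_local_imp_local_kernel[OF assms] stab_local_bounded[OF assms(1-4)]
  by (intro norm_closureI) auto

lemma cstar_r_bounded: "cstar_r G Q H \<subseteq> bounded_ops V"
  by (auto simp: cstar_r_def norm_closure_def)

section \<open>Projections and translations inside the algebra\<close>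

definition stab_class :: "'a set \<Rightarrow> 'a set \<Rightarrow> 'a set set"
  where "stab_class F y = {x \<in> V. same_stab F x y}"

text \<open>The kernel is diagonal, so its only displacement is \<open>\<one>\<close>, and the
  window \<open>F\<close> decides membership in the class.\<close>

lemma coord_proj_in_cstar_r:
  assumes "finite F" "F \<subseteq> carrier G"
  shows "coord_proj V (stab_class F y) \<in> cstar_r G Q H"
  unfolding coord_proj_def
proof (rule stab_local_in_cstar_r[of "{\<one>}" F])
  show "stab_local {\<one>} F (coord_kernel (stab_class F y))"
    unfolding stab_local_def
    by (auto simp: coord_kernel_def stab_class_def act_one same_stab_def)
qed (use assms in auto)

text \<open>On \<open>l2 V\<close> this is composition with the action of \<open>g\<close>, hence
  translation by \<open>inv g\<close> in the quasi-regular representation.\<close>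

definition shift :: "'a \<Rightarrow> 'a set operator"
  where "shift g = kernel_op V (\<lambda>x y. if y = g <# x then 1 else 0)"

lemma shift_in_cstar_r: "g \<in> carrier G \<Longrightarrow> shift g \<in> cstar_r G Q H"
  unfolding shift_def
  by (rule stab_local_in_cstar_r[of "{g}" "{}"]) (auto simp: stab_local_def)

lemma shift_bounded: "g \<in> carrier G \<Longrightarrow> shift g \<in> bounded_ops V"
  using shift_in_cstar_r cstar_r_bounded by blast

lemma shift_apply:
  assumes "g \<in> carrier G" "f \<in> l2 V"
  shows "shift g f = (\<lambda>x. if x \<in> V then f (g <# x) else 0)"
proof
  fix x
  show "shift g f x = (if x \<in> V then f (g <# x) else 0)"
  proof (cases "x \<in> V")
    case True
    then show ?thesis unfolding shift_def
      by (subst kernel_op_apply[OF assms(2) True, of "{g <# x}"]) (use assms in auto)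
  qed (simp add: shift_def kernel_op_def)
qed

text \<open>Conjugating a multiplication operator by a permutation of the coordinates pulls its set
  back; this moves a projection of an ideal around \<open>V\<close>.\<close>

lemma shift_coord_proj:
  assumes g: "g \<in> carrier G"
  shows "shift g \<circ> coord_proj V U \<circ> shift (inv g) = coord_proj V {x \<in> V. g <# x \<in> U}"
proof
  fix f
  show "(shift g \<circ> coord_proj V U \<circ> shift (inv g)) f = coord_proj V {x \<in> V. g <# x \<in> U} f"
  proof (cases "f \<in> l2 V")
    case f: True
    have 1: "shift (inv g) f \<in> l2 V"
      using bounded_opsD(1)[OF shift_bounded f] g by simp
    have 2: "coord_proj V U (shift (inv g) f) \<in> l2 V"
      using bounded_opsD(1)[OF coord_proj_bounded 1] .
    have "(shift g \<circ> coord_proj V U \<circ> shift (inv g)) f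
        = (\<lambda>x. if x \<in> V then if g <# x \<in> U then shift (inv g) f (g <# x) else 0 else 0)"
      unfolding comp_apply shift_apply[OF g 2] unfolding coord_proj_apply[OF 1] ..
    also have "\<dots> = coord_proj V {x \<in> V. g <# x \<in> U} f"
      using g by (auto simp: shift_apply[OF inv_closed[OF g] f] coord_proj_apply[OF f] act_inv)
    finally show ?thesis .
  next
    case False
    then have "shift (inv g) f = (\<lambda>x. 0)" by (simp add: shift_def kernel_op_def)
    then show ?thesis using False
      by (simp add: coord_proj_outside bounded_ops_zero[OF coord_proj_bounded]
          bounded_ops_zero[OF shift_bounded[OF g]])
  qed
qed

end

section \<open>The space of subgroups\<close>

lemma compactin_finite_subcover:
  assumes "compactin X S" "\<And>i. i \<in> I \<Longrightarrow> openin X (U i)" "S \<subseteq> (\<Union>i\<in>I. U i)"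
  obtains J where "finite J" "J \<subseteq> I" "S \<subseteq> (\<Union>i\<in>J. U i)"
proof -
  obtain \<F> where \<F>: "finite \<F>" "\<F> \<subseteq> U ` I" "S \<subseteq> \<Union>\<F>"
    using assms unfolding compactin_def by (metis (no_types, lifting) imageE)
  obtain J where "J \<subseteq> I" "finite J" "\<F> = U ` J"
    using finite_subset_image[OF \<F>(1,2)] by blast
  then show ?thesis using that \<F>(3) by blast
qed

context group
begin

section \<open>Compactness of the space of subgroups\<close>

abbreviation "indicators \<equiv> product_topology (\<lambda>_. discrete_topology (UNIV :: bool set)) (carrier G)"

lemma topspace_Sub: "topspace (Sub_topology G) = subgroups_of G"
  by (auto simp: Sub_topology_def topspace_pullback_topology)

lemma openin_indicators:
  "g \<in> carrier G \<Longrightarrow> openin indicators {\<psi> \<in> topspace indicators. \<psi> g = v}"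
  using openin_continuous_map_preimage[OF continuous_map_product_projection[of g "carrier G"
        "\<lambda>_. discrete_topology (UNIV :: bool set)"], of "{v}"] by simp

lemma closedin_indicators:
  "g \<in> carrier G \<Longrightarrow> closedin indicators {\<psi> \<in> topspace indicators. \<psi> g = v}"
  using closedin_continuous_map_preimage[OF continuous_map_product_projection[of g "carrier G"
        "\<lambda>_. discrete_topology (UNIV :: bool set)"], of "{v}"] by simp

lemma openin_Sub_mem:
  assumes "g \<in> carrier G"
  shows "openin (Sub_topology G) {K \<in> subgroups_of G. (g \<in> K) = v}"
  unfolding Sub_topology_def openin_pullback_topology
  by (rule exI[of _ "{\<psi> \<in> topspace indicators. \<psi> g = v}"])
    (use openin_indicators[OF assms] assms in auto)

lemma openin_Sub_differ:
  assumes "g \<in> carrier G" "h \<in> carrier G"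
  shows "openin (Sub_topology G) {K \<in> subgroups_of G. (g \<in> K) \<noteq> (h \<in> K)}"
proof -
  have "{K \<in> subgroups_of G. (g \<in> K) \<noteq> (h \<in> K)} =
    ({K \<in> subgroups_of G. (g \<in> K) = True} \<inter> {K \<in> subgroups_of G. (h \<in> K) = False}) \<union>
    ({K \<in> subgroups_of G. (g \<in> K) = False} \<inter> {K \<in> subgroups_of G. (h \<in> K) = True})" by auto
  then show ?thesis by (simp only:) (intro openin_Un openin_Int openin_Sub_mem assms)
qed

lemma openin_Sub_pattern:
  assumes "finite F" "\<And>h. h \<in> F \<Longrightarrow> f h \<in> carrier G"
  shows "openin (Sub_topology G) {K \<in> subgroups_of G. \<forall>h\<in>F. (f h \<in> K) = v h}"
  using assms
proof (induction F rule: finite_induct)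
  case empty
  then show ?case using openin_topspace[of "Sub_topology G"] by (simp add: topspace_Sub)
next
  case (insert h F)
  have "{K \<in> subgroups_of G. \<forall>h\<in>insert h F. (f h \<in> K) = v h} =
    {K \<in> subgroups_of G. (f h \<in> K) = v h} \<inter> {K \<in> subgroups_of G. \<forall>h\<in>F. (f h \<in> K) = v h}" by auto
  moreover have "openin (Sub_topology G) {K \<in> subgroups_of G. (f h \<in> K) = v h}"
    using insert.prems by (simp add: openin_Sub_mem)
  ultimately show ?case using insert by (simp add: openin_Int)
qed

text \<open>Each instance of a subgroup axiom involves finitely many coordinates of an indicator
  function and so cuts out a closed set; the subgroups form the intersection of these sets.\<close>

lemma closedin_subgroup_indicators:
  "closedin indicators ((\<lambda>K. \<lambda>g\<in>carrier G. g \<in> K) ` subgroups_of G)"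
proof -
  let ?C = "\<lambda>g v. {\<psi> \<in> topspace indicators. \<psi> g = v}"
  \<comment> \<open>Closure under products, an implication between coordinates turned into a union
    of closed sets; \<open>?I\<close> does the same for inverses.\<close>
  let ?M = "\<lambda>(a, b). ?C a False \<union> ?C b False \<union> ?C (a \<otimes> b) True"
  let ?I = "\<lambda>a. ?C a False \<union> ?C (inv a) True"
  let ?S = "?C \<one> True \<inter> (\<Inter>p\<in>carrier G \<times> carrier G. ?M p) \<inter> (\<Inter>a\<in>carrier G. ?I a)"
  have "closedin indicators ?S"
    using closedin_indicators[of _ True] closedin_indicators[of _ False]
    by (intro closedin_Int closedin_INT)
      (auto intro!: closedin_Un simp del: topspace_product_topology)
  moreover have "(\<lambda>K. \<lambda>g\<in>carrier G. g \<in> K) ` subgroups_of G = ?S"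
  proof (intro equalityI subsetI)
    fix \<psi> assume "\<psi> \<in> (\<lambda>K. \<lambda>g\<in>carrier G. g \<in> K) ` subgroups_of G"
    then obtain K where "subgroup K G" "\<psi> = (\<lambda>g\<in>carrier G. g \<in> K)"
      by (auto simp: subgroups_of_def)
    then show "\<psi> \<in> ?S"
      by (auto simp: subgroup.one_closed subgroup.m_closed subgroup.m_inv_closed)
  next
    fix \<psi> assume \<psi>: "\<psi> \<in> ?S"
    then have ext: "\<psi> \<in> extensional (carrier G)" by (simp add: PiE_def)
    define K where "K = {g \<in> carrier G. \<psi> g}"
    have "subgroup K G"
    proof
      show "K \<subseteq> carrier G" by (auto simp: K_def)
      show "\<one> \<in> K" using \<psi> by (simp add: K_def)
      show "x \<otimes> y \<in> K" if "x \<in> K" "y \<in> K" for x y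
      proof -
        have "\<psi> \<in> ?M (x, y)" using \<psi> that unfolding K_def by blast
        then show ?thesis using that by (simp add: K_def)
      qed
      show "inv x \<in> K" if "x \<in> K" for x
      proof -
        have "\<psi> \<in> ?I x" using \<psi> that unfolding K_def by blast
        then show ?thesis using that by (simp add: K_def)
      qed
    qed
    moreover have "\<psi> = (\<lambda>g\<in>carrier G. g \<in> K)"
      using ext by (auto simp: K_def restrict_def extensional_def)
    ultimately show "\<psi> \<in> (\<lambda>K. \<lambda>g\<in>carrier G. g \<in> K) ` subgroups_of G"
      by (auto simp: subgroups_of_def)
  qed
  ultimately show ?thesis by simp
qed

text \<open>Open sets of a pullback topology are preimages, so a cover of the subgroups becomes one
  of their indicator functions, a closed set in a product that is compact by Tychonoff.\<close>

lemma compact_space_Sub: "compact_space (Sub_topology G)"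
proof -
  let ?f = "\<lambda>K. \<lambda>g\<in>carrier G. g \<in> K"
  have "compact_space indicators"
    by (simp add: compact_space_product_topology compact_space_discrete_topology)
  then have cpt: "compactin indicators (?f ` subgroups_of G)"
    using closedin_subgroup_indicators closedin_compact_space by blast
  show ?thesis unfolding compact_space_def compactin_def
  proof (intro conjI allI impI)
    fix \<U> assume \<U>: "Ball \<U> (openin (Sub_topology G)) \<and> topspace (Sub_topology G) \<subseteq> \<Union>\<U>"
    then have "\<forall>U\<in>\<U>. \<exists>W. openin indicators W \<and> U = ?f -` W \<inter> subgroups_of G"
      by (simp add: Sub_topology_def openin_pullback_topology)
    then obtain W where W: "\<And>U. U \<in> \<U> \<Longrightarrow> openin indicators (W U)"
      "\<And>U. U \<in> \<U> \<Longrightarrow> U = ?f -` W U \<inter> subgroups_of G" by metis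
    have cover: "?f ` subgroups_of G \<subseteq> (\<Union>U\<in>\<U>. W U)"
    proof (rule image_subsetI)
      fix K assume "K \<in> subgroups_of G"
      then obtain U where "U \<in> \<U>" "K \<in> U" using \<U> topspace_Sub by blast
      then show "?f K \<in> (\<Union>U\<in>\<U>. W U)" using W(2) by blast
    qed
    obtain \<J> where \<J>: "finite \<J>" "\<J> \<subseteq> \<U>" "?f ` subgroups_of G \<subseteq> (\<Union>U\<in>\<J>. W U)"
      using compactin_finite_subcover[OF cpt W(1) cover] by blast
    have "subgroups_of G \<subseteq> \<Union>\<J>"
    proof
      fix K assume K: "K \<in> subgroups_of G"
      then obtain U where U: "U \<in> \<J>" "?f K \<in> W U" using \<J>(3) by blast
      then have "K \<in> U" using W(2)[of U] \<J>(2) K by blast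
      then show "K \<in> \<Union>\<J>" using U by blast
    qed
    then show "\<exists>\<F>. finite \<F> \<and> \<F> \<subseteq> \<U> \<and> topspace (Sub_topology G) \<subseteq> \<Union>\<F>"
      using \<J> by (auto simp: topspace_Sub)
  qed simp
qed

section \<open>Conjugation, genericity and minimality\<close>

lemma mem_conj_subgroup:
  assumes "K \<subseteq> carrier G" "g \<in> carrier G" "h \<in> carrier G"
  shows "h \<in> conj_subgroup G g K \<longleftrightarrow> inv g \<otimes> h \<otimes> g \<in> K"
proof
  assume "h \<in> conj_subgroup G g K"
  then obtain k where "k \<in> K" "h = g \<otimes> k \<otimes> inv g"
    by (auto simp: conj_subgroup_def l_coset_def r_coset_def)
  moreover from this assms have "inv g \<otimes> h \<otimes> g = k"
    by (auto simp: m_assoc inv_solve_left' subset_iff)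
  ultimately show "inv g \<otimes> h \<otimes> g \<in> K" by simp
next
  assume k: "inv g \<otimes> h \<otimes> g \<in> K"
  have "g \<otimes> (inv g \<otimes> h \<otimes> g) \<otimes> inv g = h"
    using assms by (simp add: m_assoc[symmetric]) (simp add: m_assoc)
  then show "h \<in> conj_subgroup G g K"
    using k unfolding conj_subgroup_def l_coset_def r_coset_def by force
qed

lemma conj_subgroup_subset:
  "K \<subseteq> carrier G \<Longrightarrow> g \<in> carrier G \<Longrightarrow> conj_subgroup G g K \<subseteq> carrier G"
  by (simp add: conj_subgroup_def l_coset_subset_G r_coset_subset_G)

lemma URS_subgroup: "URS G Z \<Longrightarrow> K \<in> Z \<Longrightarrow> subgroup K G"
  using closedin_subset[of "Sub_topology G" Z] by (auto simp: URS_def topspace_Sub subgroups_of_def)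

lemma URS_compact: "URS G Z \<Longrightarrow> compactin (Sub_topology G) Z"
  using closedin_compact_space[OF compact_space_Sub] by (simp add: URS_def)

text \<open>If \<open>g\<close> normalizes \<open>K\<close>, then the cosets \<open>g <# K\<close>
  and \<open>K\<close> have the same image under the map in the definition of genericity, which is
  injective.\<close>

lemma generic_self_normalizing:
  assumes "generic_URS G Z" "K \<in> Z" "g \<in> carrier G" "conj_subgroup G g K = K"
  shows "g \<in> K"
proof -
  have K: "subgroup K G" using assms URS_subgroup by (auto simp: generic_URS_def)
  obtain \<phi> where \<phi>: "\<forall>g\<in>carrier G. \<phi> (g <# K) = conj_subgroup G g K"
    "bij_betw \<phi> (lcosets K) (orbit G (conj_subgroup G) K)"
    using assms by (auto simp: generic_URS_def)
  have one: "\<one> <# K = K" using lcos_mult_one[OF subgroup.subset[OF K]] .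
  have "conj_subgroup G \<one> K = K"
    using subgroup.subset[OF K] by (simp add: conj_subgroup_def one)
  then have "\<phi> (g <# K) = \<phi> (\<one> <# K)" using \<phi>(1) assms by simp
  moreover have "g <# K \<in> lcosets K" "\<one> <# K \<in> lcosets K"
    using assms by (auto simp: LCOSETS_def)
  ultimately have "g <# K = K"
    using \<phi>(2) one by (auto simp: bij_betw_def inj_on_def)
  then show ?thesis using lcos_self[OF assms(3) K] by simp
qed

text \<open>By genericity, conjugation by \<open>g\<close> moves every member of \<open>Z\<close>
  that omits \<open>g\<close>. Some \<open>h\<close> witnesses this and still does so on an open
  neighbourhood; the members that omit \<open>g\<close> form a compact set.\<close>

lemma generic_separation:
  assumes gen: "generic_URS G Z" and g: "g \<in> carrier G"
  obtains F where "finite F" "F \<subseteq> carrier G"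
    "\<And>K. K \<in> Z \<Longrightarrow> g \<notin> K \<Longrightarrow> \<exists>h\<in>F. (h \<in> K) \<noteq> (inv g \<otimes> h \<otimes> g \<in> K)"
proof -
  have Z: "URS G Z" using gen by (simp add: generic_URS_def)
  let ?N = "{K \<in> subgroups_of G. (g \<in> K) = True}"
  let ?U = "\<lambda>h. {K \<in> subgroups_of G. (h \<in> K) \<noteq> (inv g \<otimes> h \<otimes> g \<in> K)}"
  have "closedin (Sub_topology G) (Z - ?N)"
    using Z openin_Sub_mem[OF g] unfolding URS_def by (intro closedin_diff) blast+
  then have cpt: "compactin (Sub_topology G) (Z - ?N)"
    using closedin_compact_space[OF compact_space_Sub] by blast
  have op: "openin (Sub_topology G) (?U h)" if "h \<in> carrier G" for h
    using that g by (intro openin_Sub_differ) auto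
  have cover: "Z - ?N \<subseteq> (\<Union>h\<in>carrier G. ?U h)"
  proof
    fix K assume K: "K \<in> Z - ?N"
    then have sub: "subgroup K G" using URS_subgroup Z by blast
    then have "g \<notin> K" using K by (simp add: subgroups_of_def)
    then have "conj_subgroup G g K \<noteq> K" using generic_self_normalizing[OF gen _ g] K by blast
    then obtain h where "(h \<in> K) \<noteq> (h \<in> conj_subgroup G g K)" by blast
    moreover from this have "h \<in> carrier G"
      using subgroup.subset[OF sub] conj_subgroup_subset[OF _ g] by blast
    ultimately show "K \<in> (\<Union>h\<in>carrier G. ?U h)"
      using mem_conj_subgroup[OF subgroup.subset[OF sub] g] sub by (auto simp: subgroups_of_def)
  qed
  obtain F where F: "finite F" "F \<subseteq> carrier G" "Z - ?N \<subseteq> (\<Union>h\<in>F. ?U h)"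
    using compactin_finite_subcover[OF cpt op cover] by blast
  show ?thesis
  proof (rule that[OF F(1,2)])
    fix K assume "K \<in> Z" "g \<notin> K"
    then show "\<exists>h\<in>F. (h \<in> K) \<noteq> (inv g \<otimes> h \<otimes> g \<in> K)" using F(3) by blast
  qed
qed

text \<open>By minimality every member of \<open>Z\<close> has a conjugate that agrees with
  \<open>K0\<close> on \<open>F\<close>. Agreement is an open condition, so compactness leaves
  finitely many conjugators.\<close>

lemma URS_recurrence:
  assumes Z: "URS G Z" and K0: "K0 \<in> Z" and F: "finite F" "F \<subseteq> carrier G"
  obtains \<Gamma> where "finite \<Gamma>" "\<Gamma> \<subseteq> carrier G"
    "\<And>K. K \<in> Z \<Longrightarrow> \<exists>g\<in>\<Gamma>. \<forall>h\<in>F. (inv g \<otimes> h \<otimes> g \<in> K) = (h \<in> K0)"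
proof -
  let ?U = "\<lambda>g. {K \<in> subgroups_of G. \<forall>h\<in>F. (inv g \<otimes> h \<otimes> g \<in> K) = (h \<in> K0)}"
  have sub: "K \<subseteq> carrier G" "K \<in> subgroups_of G" if "K \<in> Z" for K
    using URS_subgroup[OF Z that] subgroup.subset by (auto simp: subgroups_of_def)
  have op: "openin (Sub_topology G) (?U g)" if "g \<in> carrier G" for g
    using that F by (intro openin_Sub_pattern) auto
  \<comment> \<open>The members of \<open>Z\<close> with no such conjugate: a closed invariant set
    that misses \<open>K0\<close>, hence empty.\<close>
  define Y where "Y = Z - (\<Union>g\<in>carrier G. ?U g)"
  have "closedin (Sub_topology G) Y"
    unfolding Y_def using Z op by (intro closedin_diff openin_Union) (auto simp: URS_def)
  moreover have "conj_invariant G Y"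
    unfolding conj_invariant_def
  proof (intro ballI)
    fix a K assume a: "a \<in> carrier G" and "K \<in> Y"
    then have K: "K \<in> Z" "\<And>g. g \<in> carrier G \<Longrightarrow> K \<notin> ?U g" by (auto simp: Y_def)
    have cZ: "conj_subgroup G a K \<in> Z" using Z K a by (auto simp: URS_def conj_invariant_def)
    have "conj_subgroup G a K \<notin> ?U g" if g: "g \<in> carrier G" for g
    proof
      assume "conj_subgroup G a K \<in> ?U g"
      then have "\<forall>h\<in>F. (inv a \<otimes> (inv g \<otimes> h \<otimes> g) \<otimes> a \<in> K) = (h \<in> K0)"
        using mem_conj_subgroup[OF sub(1)[OF K(1)] a] g F(2) by (simp add: subset_iff)
      \<comment> \<open>Conjugating by \<open>a\<close> and then by \<open>g\<close> is conjugating
        by \<open>g \<otimes> a\<close>.\<close>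
      moreover have "inv a \<otimes> (inv g \<otimes> h \<otimes> g) \<otimes> a = inv (g \<otimes> a) \<otimes> h \<otimes> (g \<otimes> a)" if "h \<in> F" for h
        using that a g F(2) by (simp add: inv_mult_group m_assoc subset_iff)
      ultimately have "K \<in> ?U (g \<otimes> a)" using sub(2)[OF K(1)] by simp
      then show False using K(2) a g by blast
    qed
    then show "conj_subgroup G a K \<in> Y" using cZ by (simp add: Y_def)
  qed
  moreover have "K0 \<in> ?U \<one>" using sub(2)[OF K0] F(2) by (simp add: subset_iff)
  then have "K0 \<notin> Y" unfolding Y_def using one_closed by blast
  moreover have "Y \<subseteq> Z" by (auto simp: Y_def)
  moreover have "W = Z" if "W \<subseteq> Z" "W \<noteq> {}" "closedin (Sub_topology G) W" "conj_invariant G W" for W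
    using Z that by (simp add: URS_def)
  ultimately have "Y = {}" using K0 by blast
  then have cover: "Z \<subseteq> (\<Union>g\<in>carrier G. ?U g)" by (auto simp: Y_def)
  obtain \<Gamma> where \<Gamma>: "finite \<Gamma>" "\<Gamma> \<subseteq> carrier G" "Z \<subseteq> (\<Union>g\<in>\<Gamma>. ?U g)"
    using compactin_finite_subcover[OF URS_compact[OF Z] op cover] by blast
  show ?thesis
    by (rule that[OF \<Gamma>(1,2)]) (use \<Gamma>(3) in blast)
qed

end

section \<open>Simplicity\<close>

locale generic_schreier_graph = schreier_graph +
  fixes Z
  assumes generic: "generic_URS G Z" and base: "H \<in> Z"
begin

lemma URS: "URS G Z"
  using generic by (simp add: generic_URS_def)

section \<open>Vertex stabilizers as points of the URS\<close>

definition stab :: "'a set \<Rightarrow> 'a set"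
  where "stab x = {g \<in> carrier G. g <# x = x}"

lemma stab_act:
  assumes "g \<in> carrier G" "h \<in> carrier G" "x \<in> V"
  shows "h <# (g <# x) = g <# x \<longleftrightarrow> inv g \<otimes> h \<otimes> g \<in> stab x"
  using assms by (simp add: stab_def act_mult act_eq_iff m_assoc)

text \<open>The stabilizer of \<open>a <# H\<close> is the conjugate of \<open>H\<close> by
  \<open>a\<close>, and \<open>Z\<close> is invariant.\<close>

lemma stab_in_URS:
  assumes "x \<in> V"
  shows "stab x \<in> Z"
proof -
  obtain a where a: "a \<in> carrier G" "x = a <# H" using coset_cases assms by blast
  have sub: "H \<subseteq> carrier G" using subgroup.subset[OF H] .
  \<comment> \<open>The base vertex has stabilizer \<open>H\<close>; \<open>stab_act\<close> carries
    this to the other vertices.\<close>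
  have fix_iff: "k <# H = H \<longleftrightarrow> k \<in> H" if "k \<in> carrier G" for k
  proof
    show "k <# H = H \<Longrightarrow> k \<in> H" using lcos_self[OF that H] by simp
    assume k: "k \<in> H"
    show "k <# H = H"
    proof
      show "k <# H \<subseteq> H" using k subgroup.m_closed[OF H] by (auto simp: l_coset_def)
      show "H \<subseteq> k <# H"
      proof
        fix h assume h: "h \<in> H"
        then have "inv k \<otimes> h \<in> H" "h = k \<otimes> (inv k \<otimes> h)"
          using k sub subgroup.m_closed[OF H] subgroup.m_inv_closed[OF H]
          by (auto simp: m_assoc[symmetric] subset_iff)
        then show "h \<in> k <# H" by (auto simp: l_coset_def)
      qed
    qed
  qed
  have "stab x = conj_subgroup G a H"
  proof (intro equalityI subsetI)
    fix g assume "g \<in> stab x"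
    then show "g \<in> conj_subgroup G a H"
      using a stab_act[OF a(1) _ base_in, of g] mem_conj_subgroup[OF sub a(1), of g] fix_iff
      by (simp add: stab_def)
  next
    fix g assume g: "g \<in> conj_subgroup G a H"
    then have gc: "g \<in> carrier G" using conj_subgroup_subset[OF sub a(1)] by blast
    then have "inv a \<otimes> g \<otimes> a \<in> H" using g mem_conj_subgroup[OF sub a(1)] by blast
    then show "g \<in> stab x"
      using a gc stab_act[OF a(1) gc base_in] fix_iff by (simp add: stab_def)
  qed
  then show ?thesis using URS base a by (simp add: URS_def conj_invariant_def)
qed

text \<open>The stabilizer of \<open>g <# x\<close> is that of \<open>x\<close> conjugated by
  \<open>g\<close>, so \<open>generic_separation\<close> tells the two apart unless \<open>g\<close>
  fixes \<open>x\<close>. The windows of the finitely many \<open>g\<close> are united.\<close>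

lemma stab_separation:
  assumes "finite E" "E \<subseteq> carrier G"
  obtains F where "finite F" "F \<subseteq> carrier G"
    "\<And>x g. x \<in> V \<Longrightarrow> g \<in> E \<Longrightarrow> same_stab F x (g <# x) \<Longrightarrow> g <# x = x"
proof -
  have "\<exists>F. finite F \<and> F \<subseteq> carrier G \<and>
      (\<forall>K\<in>Z. g \<notin> K \<longrightarrow> (\<exists>h\<in>F. (h \<in> K) \<noteq> (inv g \<otimes> h \<otimes> g \<in> K)))" if "g \<in> E" for g
    by (rule generic_separation[OF generic, of g]) (use that assms(2) in blast)+
  then obtain F where F: "\<And>g. g \<in> E \<Longrightarrow> finite (F g) \<and> F g \<subseteq> carrier G \<and>
      (\<forall>K\<in>Z. g \<notin> K \<longrightarrow> (\<exists>h\<in>F g. (h \<in> K) \<noteq> (inv g \<otimes> h \<otimes> g \<in> K)))"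
    by metis
  show ?thesis
  proof (rule that[of "\<Union>g\<in>E. F g"])
    show "finite (\<Union>g\<in>E. F g)" "(\<Union>g\<in>E. F g) \<subseteq> carrier G" using F assms by auto
    fix x g assume x: "x \<in> V" and g: "g \<in> E" and same: "same_stab (\<Union>g\<in>E. F g) x (g <# x)"
    show "g <# x = x"
    proof (rule ccontr)
      assume "g <# x \<noteq> x"
      then have "g \<notin> stab x" by (simp add: stab_def)
      then obtain h where h: "h \<in> F g" "(h \<in> stab x) \<noteq> (inv g \<otimes> h \<otimes> g \<in> stab x)"
        using F[OF g] stab_in_URS[OF x] by blast
      have hc: "h \<in> carrier G" using h F[OF g] by blast
      have "h <# x = x \<longleftrightarrow> h <# (g <# x) = g <# x"
        using same h g unfolding same_stab_def by blast
      then show False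
        using h(2) stab_act[OF _ hc x, of g] g assms(2) hc by (auto simp: stab_def)
    qed
  qed
qed

text \<open>Recurrence of the point \<open>stab y\<close> of \<open>Z\<close>, read back on vertices
  through \<open>stab\<close>.\<close>

lemma stab_class_translates:
  assumes "finite F" "F \<subseteq> carrier G" "y \<in> V"
  obtains \<Gamma> where "finite \<Gamma>" "\<Gamma> \<subseteq> carrier G" "V = (\<Union>g\<in>\<Gamma>. {x \<in> V. g <# x \<in> stab_class F y})"
proof -
  obtain \<Gamma> where \<Gamma>: "finite \<Gamma>" "\<Gamma> \<subseteq> carrier G"
    "\<And>K. K \<in> Z \<Longrightarrow> \<exists>g\<in>\<Gamma>. \<forall>h\<in>F. (inv g \<otimes> h \<otimes> g \<in> K) = (h \<in> stab y)"
    using URS_recurrence[OF URS stab_in_URS[OF assms(3)] assms(1,2)] by blast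
  have "\<exists>g\<in>\<Gamma>. g <# x \<in> stab_class F y" if x: "x \<in> V" for x
  proof -
    obtain g where g: "g \<in> \<Gamma>" "\<forall>h\<in>F. (inv g \<otimes> h \<otimes> g \<in> stab x) = (h \<in> stab y)"
      using \<Gamma>(3)[OF stab_in_URS[OF x]] by blast
    have gc: "g \<in> carrier G" using g \<Gamma> by blast
    have "same_stab F (g <# x) y"
      unfolding same_stab_def
    proof
      fix h assume h: "h \<in> F"
      then have "h \<in> carrier G" using assms by blast
      then show "h <# (g <# x) = g <# x \<longleftrightarrow> h <# y = y"
        using stab_act[OF gc _ x, of h] g(2) h by (simp add: stab_def)
    qed
    then have "g <# x \<in> stab_class F y" using gc x by (simp add: stab_class_def)
    then show ?thesis using g(1) by blast
  qed
  then show ?thesis using that[OF \<Gamma>(1,2)] by blast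
qed

text \<open>Between distinct vertices of the class the kernel has no entries, since
  \<open>sep\<close> forbids a nontrivial move by \<open>E\<close> inside the class. The diagonal is
  constant there, since \<open>F'\<close> contains the window of the kernel.\<close>

lemma compress_kernel_op:
  assumes K: "stab_local E F K" and E: "finite E" "E \<subseteq> carrier G" "E \<subseteq> F'" and F: "finite F" "F \<subseteq> F'"
    and sep: "\<And>x g. x \<in> V \<Longrightarrow> g \<in> E \<Longrightarrow> same_stab F' x (g <# x) \<Longrightarrow> g <# x = x"
    and y: "y \<in> V" and nz: "K y y \<noteq> 0" and f: "f \<in> l2 V"
  defines "P \<equiv> coord_proj V (stab_class F' y)"
  shows "P (kernel_op V K (P f)) = (\<lambda>x. K y y * P f x)"
proof
  fix x
  have Pf: "P f \<in> l2 V" unfolding P_def by (rule bounded_opsD(1)[OF coord_proj_bounded f])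
  have KPf: "kernel_op V K (P f) \<in> l2 V"
    by (rule bounded_opsD(1)[OF stab_local_bounded[OF K E(1) F(1) E(2)] Pf])
  show "P (kernel_op V K (P f)) x = K y y * P f x"
  proof (cases "x \<in> stab_class F' y")
    case True
    then have x: "x \<in> V" and xy: "same_stab F' x y" by (auto simp: stab_class_def)
    \<comment> \<open>A nonzero diagonal entry comes from some \<open>g\<close> in \<open>E\<close>
      that fixes \<open>y\<close>. As \<open>E\<close> lies in \<open>F'\<close>, this
      \<open>g\<close> also fixes \<open>x\<close>, so \<open>K x x\<close> is an entry that the
      window controls.\<close>
    obtain g where g: "g \<in> E" "y = g <# y" using K nz y unfolding stab_local_def by blast
    have "same_stab F x y" using xy F(2) by (auto simp: same_stab_def)
    then have "K x (g <# x) = K y (g <# y)" using K g(1) x y unfolding stab_local_def by blast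
    moreover have "g <# x = x" using xy g E(3) unfolding same_stab_def by auto
    ultimately have diag: "K x x = K y y" using g(2) by simp
    let ?N = "insert x ((\<lambda>g. g <# x) ` E)"
    have "kernel_op V K (P f) x = (\<Sum>z\<in>?N. K x z * P f z)"
    proof (rule kernel_op_apply[OF Pf x])
      show "finite ?N" "?N \<subseteq> V" using E x by auto
      show "K x z = 0" if "z \<in> V" "z \<notin> ?N" for z
        using K that x unfolding stab_local_def by blast
    qed
    also have "\<dots> = (\<Sum>z\<in>?N. if z = x then K x x * P f x else 0)"
    proof (rule sum.cong[OF refl])
      fix z assume z: "z \<in> ?N"
      have "z \<notin> stab_class F' y" if zx: "z \<noteq> x"
      proof
        assume "z \<in> stab_class F' y"
        then have "same_stab F' x z" using xy by (auto simp: same_stab_def stab_class_def)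
        then show False using sep[OF x] z zx by blast
      qed
      then show "K x z * P f z = (if z = x then K x x * P f x else 0)"
        by (auto simp: P_def coord_proj_apply[OF f])
    qed
    also have "\<dots> = K x x * P f x" using E by simp
    finally have "kernel_op V K (P f) x = K y y * P f x" using diag by simp
    moreover have "P (kernel_op V K (P f)) x = kernel_op V K (P f) x"
      using True by (simp add: P_def coord_proj_apply[OF KPf[unfolded P_def]])
    ultimately show ?thesis by simp
  next
    case False
    have "P g x = 0" for g
      using False by (cases "g \<in> l2 V") (simp_all add: P_def coord_proj_apply coord_proj_outside)
    then show ?thesis by simp
  qed
qed

section \<open>From a nonzero ideal to the identity\<close>

theorem simple: "simple_cstar V (cstar_r G Q H)"
  unfolding simple_cstar_def
proof (intro conjI allI impI)
  \<comment> \<open>With an empty window the class is everything, so the identity lies in the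
    algebra.\<close>
  have "stab_class {} H = V" by (auto simp: stab_class_def same_stab_def)
  then have "coord_proj V V \<in> cstar_r G Q H" using coord_proj_in_cstar_r[of "{}" H] by simp
  moreover have "coord_proj V V (basis_vec H) H \<noteq> op_zero (basis_vec H) H"
    unfolding coord_proj_apply[OF basis_vec_l2[OF base_in]]
    using base_in by (simp add: op_zero_def basis_vec_def)
  ultimately show "cstar_r G Q H \<noteq> {op_zero}" by fastforce
next
  fix I assume ideal: "closed_two_sided_ideal V (cstar_r G Q H) I"
  note bounded = cstar_r_bounded
  have IA: "I \<subseteq> cstar_r G Q H"
    and left: "\<And>S T. T \<in> cstar_r G Q H \<Longrightarrow> S \<in> I \<Longrightarrow> T \<circ> S \<in> I"
    and right: "\<And>S T. T \<in> cstar_r G Q H \<Longrightarrow> S \<in> I \<Longrightarrow> S \<circ> T \<in> I"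
    and scale: "\<And>c S. S \<in> I \<Longrightarrow> op_scale c S \<in> I"
    using ideal by (auto simp: closed_two_sided_ideal_def)
  show "I = {op_zero} \<or> I = cstar_r G Q H"
  proof (cases "I = {op_zero}")
    case False
    moreover have "op_zero \<in> I" using ideal by (simp add: closed_two_sided_ideal_def)
    ultimately obtain T0 where T0: "T0 \<in> I" "T0 \<noteq> op_zero" by blast
    have T0b: "T0 \<in> bounded_ops V" using T0 IA bounded by blast
    obtain y where y: "y \<in> V" "T0 (basis_vec y) \<noteq> (\<lambda>x. 0)"
      using bounded_op_eq_zeroI[OF T0b] T0(2) by blast
    then obtain x where x: "T0 (basis_vec y) x \<noteq> 0" by blast
    have T0y: "T0 (basis_vec y) \<in> l2 V" using bounded_opsD(1)[OF T0b] y by simp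
    then have "x \<in> V" using x l2_outside[OF T0y] by blast
    then obtain a where a: "a \<in> carrier G" "x = a <# y" using act_transitive[OF y(1) \<open>x \<in> V\<close>] by blast
    \<comment> \<open>Moves the nonzero entry at \<open>(x, y)\<close> to the diagonal position
      \<open>(y, y)\<close>.\<close>
    define T where "T = shift a \<circ> T0"
    have T: "T \<in> I" unfolding T_def by (intro left shift_in_cstar_r a T0)
    have Tb: "T \<in> bounded_ops V" using T IA bounded by blast
    define t where "t = T (basis_vec y) y"
    have t: "t \<noteq> 0" using x a y by (simp add: t_def T_def shift_apply[OF a(1) T0y])
    \<comment> \<open>An error of a quarter leaves \<open>cmod c\<close> at least three quarters of
      \<open>cmod t\<close>, so dividing by \<open>c\<close> below gives the contraction ratio
      \<open>1 / 3\<close>.\<close>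
    then have "cmod t / 4 > 0" by simp
    then obtain K where K: "local_kernel G Q H K"
      and near: "op_norm V (op_diff T (kernel_op V K)) < cmod t / 4"
      using T IA unfolding cstar_r_def norm_closure_def by blast
    obtain E F where E: "finite E" "E \<subseteq> carrier G" and F: "finite F" "F \<subseteq> carrier G"
      and EF: "stab_local E F K"
      using local_kernel_imp_stab_local[OF K] by metis
    have Kb: "kernel_op V K \<in> bounded_ops V" by (rule stab_local_bounded[OF EF E(1) F(1) E(2)])
    define D where "D = op_diff T (kernel_op V K)"
    have Db: "D \<in> bounded_ops V" unfolding D_def by (rule op_diff_bounded[OF Tb Kb])
    have D: "l2_norm V (D f) \<le> cmod t / 4 * l2_norm V f" if "f \<in> l2 V" for f
    proof -
      have "l2_norm V (D f) \<le> op_norm V D * l2_norm V f" by (rule l2_norm_le_op_norm[OF Db that])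
      also have "\<dots> \<le> cmod t / 4 * l2_norm V f"
        using near by (intro mult_right_mono) (auto simp: D_def)
      finally show ?thesis .
    qed
    define c where "c = K y y"
    have "kernel_op V K (basis_vec y) y = c"
    proof -
      let ?N = "insert y ((\<lambda>g. g <# y) ` E)"
      have "kernel_op V K (basis_vec y) y = (\<Sum>z\<in>?N. K y z * basis_vec y z)"
      proof (rule kernel_op_apply[OF basis_vec_l2[OF y(1)] y(1)])
        show "finite ?N" "?N \<subseteq> V" using E y by auto
        show "K y z = 0" if "z \<in> V" "z \<notin> ?N" for z
          using EF that y unfolding stab_local_def by blast
      qed
      also have "\<dots> = (\<Sum>z\<in>?N. if z = y then c else 0)"
        by (rule sum.cong) (auto simp: basis_vec_def c_def)
      finally show ?thesis using E by simp
    qed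
    then have "D (basis_vec y) y = t - c" by (simp add: D_def op_diff_def t_def)
    then have "cmod (t - c) \<le> cmod t / 4"
      using cmod_le_l2_norm[OF bounded_opsD(1)[OF Db basis_vec_l2[OF y(1)]] y(1)]
        D[OF basis_vec_l2[OF y(1)]] l2_norm_basis_vec[OF y(1)] by simp
    then have c: "cmod c \<ge> 3 / 4 * cmod t"
      using norm_triangle_ineq2[of t c] by linarith
    then have c0: "c \<noteq> 0" using t by auto
    obtain F1 where F1: "finite F1" "F1 \<subseteq> carrier G"
      "\<And>x g. x \<in> V \<Longrightarrow> g \<in> E \<Longrightarrow> same_stab F1 x (g <# x) \<Longrightarrow> g <# x = x"
      using stab_separation[OF E] by blast
    \<comment> \<open>\<open>E\<close> lets the class decide which displacements fix its vertices,
      \<open>F\<close> makes the kernel entries constant on it, and \<open>F1\<close> excludes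
      off-diagonal ones.\<close>
    define F' where "F' = E \<union> F \<union> F1"
    have F': "finite F'" "F' \<subseteq> carrier G" using E F F1 by (auto simp: F'_def)
    have sep: "g <# x = x" if "x \<in> V" "g \<in> E" "same_stab F' x (g <# x)" for x g
      using F1(3)[OF that(1,2)] that(3) by (auto simp: F'_def same_stab_def)
    define P where "P = coord_proj V (stab_class F' y)"
    have PA: "P \<in> cstar_r G Q H" unfolding P_def by (rule coord_proj_in_cstar_r[OF F'])
    have Pb: "P \<in> bounded_ops V" and Pn: "\<And>f. f \<in> l2 V \<Longrightarrow> l2_norm V (P f) \<le> l2_norm V f"
      and PP: "P \<circ> P = P"
      unfolding P_def by (auto simp: coord_proj_bounded coord_proj_norm coord_proj_comp)
    \<comment> \<open>This includes \<open>f\<close> outside \<open>l2 V\<close>, where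
      \<open>P f\<close> is 0, so that the operator identities below hold at every argument.\<close>
    have Pl2: "P f \<in> l2 V" for f
      using bounded_opsD(1,4)[OF Pb, of f] by (cases "f \<in> l2 V") simp_all
    have PPf: "P (P f) = P f" for f using fun_cong[OF PP, of f] by simp
    have PK: "P (kernel_op V K (P f)) = (\<lambda>x. c * P f x)" if "f \<in> l2 V" for f
      unfolding P_def c_def
      by (rule compress_kernel_op[OF EF E _ F(1) _ sep y(1) _ that])
        (use c0 in \<open>auto simp: F'_def c_def\<close>)
    \<comment> \<open>The compression of \<open>T\<close>, scaled so that \<open>P - S\<close> is
      \<open>- 1 / c\<close> times the compression of the error \<open>D\<close> on
      \<open>l2 V\<close>.\<close>
    define S where "S = op_scale (1 / c) (P \<circ> T \<circ> P)"
    have S: "S \<in> I" unfolding S_def by (intro scale left right PA T)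
    have "P \<in> I"
    proof (rule idempotent_in_ideal[OF ideal bounded Pb S _ _ PP Pn])
      show "P \<circ> S = S"
      proof
        fix f
        have "P (\<lambda>x. (1 / c) * P (T (P f)) x) = (\<lambda>x. (1 / c) * P (P (T (P f))) x)"
          by (rule bounded_opsD(3)[OF Pb Pl2])
        then show "(P \<circ> S) f = S f" by (simp add: S_def op_scale_def PPf)
      qed
      show "S \<circ> P = S" by (auto simp: S_def op_scale_def PPf)
      show "l2_norm V (op_diff P S f) \<le> 1 / 3 * l2_norm V f" if f: "f \<in> l2 V" for f
      proof -
        have TP: "T (P f) \<in> l2 V" "kernel_op V K (P f) \<in> l2 V"
          using bounded_opsD(1) Tb Kb Pl2 by blast+
        have "P (D (P f)) = (\<lambda>x. P (T (P f)) x - c * P f x)"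
          unfolding D_def op_diff_def bounded_ops_diff[OF Pb TP] PK[OF f] ..
        then have "op_diff P S f = (\<lambda>x. (- 1 / c) * P (D (P f)) x)"
          using c0 by (auto simp: op_diff_def S_def op_scale_def field_simps)
        then have "l2_norm V (op_diff P S f) \<le> cmod (- 1 / c) * l2_norm V (P (D (P f)))"
          by (simp only:) (rule l2_scale(2)[OF Pl2])
        also have "\<dots> \<le> cmod (- 1 / c) * (cmod t / 4 * l2_norm V f)"
        proof (intro mult_left_mono)
          have "l2_norm V (P (D (P f))) \<le> l2_norm V (D (P f))"
            by (rule Pn[OF bounded_opsD(1)[OF Db Pl2]])
          also have "\<dots> \<le> cmod t / 4 * l2_norm V (P f)" by (rule D[OF Pl2])
          also have "\<dots> \<le> cmod t / 4 * l2_norm V f"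
            by (intro mult_left_mono Pn f) simp
          finally show "l2_norm V (P (D (P f))) \<le> cmod t / 4 * l2_norm V f" .
        qed simp
        also have "\<dots> = (cmod t / 4 / cmod c) * l2_norm V f" by (simp add: norm_divide)
        also have "\<dots> \<le> 1 / 3 * l2_norm V f"
        proof (intro mult_right_mono)
          show "cmod t / 4 / cmod c \<le> 1 / 3" using c c0 by (simp add: divide_le_eq)
        qed simp
        finally show ?thesis .
      qed
    qed simp_all
    obtain \<Gamma> where \<Gamma>: "finite \<Gamma>" "\<Gamma> \<subseteq> carrier G"
      "V = (\<Union>g\<in>\<Gamma>. {x \<in> V. g <# x \<in> stab_class F' y})"
      using stab_class_translates[OF F' y(1)] by blast
    have "coord_proj V {x \<in> V. g <# x \<in> stab_class F' y} \<in> I" if "g \<in> \<Gamma>" for g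
    proof -
      have g: "g \<in> carrier G" using that \<Gamma> by blast
      then have "shift g \<circ> P \<circ> shift (inv g) \<in> I"
        using \<open>P \<in> I\<close> by (intro left right shift_in_cstar_r) auto
      then show ?thesis unfolding P_def shift_coord_proj[OF g] .
    qed
    then have "coord_proj V (\<Union>((\<lambda>g. {x \<in> V. g <# x \<in> stab_class F' y}) ` \<Gamma>)) \<in> I"
      using \<Gamma>(1) by (intro ideal_coord_proj_Union[OF ideal]) auto
    then have "coord_proj V V \<in> I" using \<Gamma>(3) by simp
    then have "I = cstar_r G Q H" by (rule ideal_eq_algebraI[OF ideal bounded])
    then show ?thesis ..
  qed simp
qed

end

theorem theorem7:
  fixes G :: "('a, 'm) monoid_scheme" and Q :: "'a set" and Z :: "'a set set" and H :: "'a set"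
  assumes "group G"
    and "finite Q" and "Q \<subseteq> carrier G" and "generate G Q = carrier G"
    and "generic_URS G Z"
    and "H \<in> Z"
  shows "simple_cstar (lcosets\<^bsub>G\<^esub> H) (cstar_r G Q H)"
proof -
  interpret group G by fact
  have "subgroup H G" using URS_subgroup assms(5,6) by (auto simp: generic_URS_def)
  then interpret generic_schreier_graph G Q H Z
    using assms
    by (intro generic_schreier_graph.intro schreier_graph.intro schreier_graph_axioms.intro
        generic_schreier_graph_axioms.intro)
  show ?thesis by (rule simple)
qed

end
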